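(* Let $d\ge 1$ and let $Q\subseteq\mathrm{Rel}(A)$ be a set of finitary relations on the finite set $A$. The following are equivalent: (i) $\Xi_d(Q)$ holds, i.e. $\mathrm{Pol}\,Q=(\mathrm{Pol}^{(d)}Q)^{*_d}$; (ii) there exists $Q'\subseteq{}^{d}\mathrm{GQuord}(A)$ such that $\mathrm{Pol}\,Q=\mathrm{Pol}\,Q'$ $(=\mathrm{Pol}\,\mathring Q')$; (ii)$'$ there exists $Q'\subseteq{}^{d}\mathrm{GQuord}(A)$ such that $[Q]_{\exists,\wedge,=}=[\mathring Q']_{\exists,\wedge,=}$; (iii) there exists a $d$-ary clone fragment $M\le A^{A^d}$ containing all $d$-ary constant operations such that $M$ (considered as an R-relation of arity $A^d$) belongs to ${}^{d}\mathrm{GQuord}(A)$ and $[Q]_{\exists,\wedge,=}=[\mathring M]_{\exists,\wedge,=}$.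
   Context: Standing assumptions: $A$ is a finite nonempty set; all sets $B,B_i$ are finite and nonempty. $\mathrm{Op}(A)$ is the set of all operations $f:A^n\to A$, $n\ge1$; $\mathrm{Rel}(A)$ the set of all relations $\rho\subseteq A^m$, $m\ge1$. A clone is a subset of $\mathrm{Op}(A)$ containing all projections and closed under composition; $\langle F\rangle$ is the clone generated by $F$ and $F^{(d)}$ the set of $d$-ary members of $F$. A $d$-ary clone fragment is a set $M\subseteq A^{A^d}$ of $d$-ary operations with $M=\langle M\rangle^{(d)}$ (notation $M\le A^{A^d}$). $\mathrm{trl}_d(f)$, for $f:A^n\to A$, is the set of all $d$-ary operations obtained from $f$ by substituting constants from $A$ for some (possibly none, possibly all) of its variables, keeping the remaining $t\le d$ variables in their order, and then prepending $u$ and appending $v$ fictitious variables, $u+t+v=d$. For $M\subseteq A^{A^d}$, $M^{*_d}:=\{f\in\mathrm{Op}(A)\mid \mathrm{trl}_d(f)\subseteq M\}$. R-relations. For $h:B^{n+1}\to A$, $\mathrm{ebtrl}(h)$ is the set of all $(x_0,\dots,x_{n-1})\mapsto h(x_0,\dots,x_{i-1},c,x_i,\dots,x_{n-1})$ with $0\le i\le n$, $c\in B$. For $g:B^n\to A$, $\mathrm{eftrl}(g)$ consists of $(x_0,\dots,x_n)\mapsto g(x_1,\dots,x_n)$ and $(x_0,\dots,x_n)\mapsto g(x_0,\dots,x_{n-1})$. For $\rho\subseteq A^{B^d}$: $\circledast(\rho):=\{h\in A^{B^{d+1}}\mid\mathrm{ebtrl}(h)\subseteq\rho\}$. For $h\in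 A^{B^{d+1}}$, $\mathbf\Delta(h)$ is the set of all $(x_0,\dots,x_{d-1})\mapsto h(x_0,\dots,x_{j-1},x_i,x_j,\dots,x_{d-1})$, $0\le i<j\le d$. ($\mathrm{ebtrl},\mathrm{eftrl},\mathbf\Delta$ extend to sets by unions.) $\rho\subseteq A^{B^d}$ is internally reflexive if $\mathrm{eftrl}(\rho)\subseteq\circledast(\rho)$, transitive if $\mathbf\Delta(\circledast(\rho))\subseteq\rho$. An R-relation of arity $\alpha=\alpha_1\times\dots\times\alpha_s$, $\alpha_j=B_j^{d_j}$, is a set $\rho\subseteq A^\alpha$ of functions $\alpha\to A$; its dimension is $d_1+\dots+d_s$. With $\alpha/\alpha_j$ the product with $j$-th factor deleted and $g^{(\alpha_j)}:\alpha_j\to A^{\alpha/\alpha_j}$ the currying $g^{(\alpha_j)}(X_j)(X_1,\dots,X_{j-1},X_{j+1},\dots,X_s)=g(X_1,\dots,X_s)$, put $\rho^{(\alpha_j)}:=\{g^{(\alpha_j)}\mid g\in\rho\}$, a relation of simple arity $B_j^{d_j}$ over base set $A^{\alpha/\alpha_j}$. $\rho$ is internally reflexive (transitive) if all $\rho^{(\alpha_j)}$ are; $\rho$ is a generalized quasiorder if it is internally reflexive, transitive and contains all constant functions $\alpha\to A$. ${}^{d}\mathrm{GQuord}(A)$ is the set of all $d$-dimensional generalized quasiorders on $A$ of canonical arity $m_1^{d_1}\times\dots\times m_s^{d_s}$, $m_i,d_i\ge1$, where $m_i=\{0,\dots,m_i-1\}$. $A$ is identified with the ordinal $|A|$, so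 that the arity $A^d$ is canonical and a set $M\subseteq A^{A^d}$ is an R-relation of simple arity $A^d$. Preservation: $f:A^n\to A$ preserves an R-relation $\rho\subseteq A^\alpha$ if for all $g_1,\dots,g_n\in\rho$ the function $b\mapsto f(g_1(b),\dots,g_n(b))$ is in $\rho$; for $\rho\subseteq A^m$ this is the usual notion. $\mathrm{Pol}\,T$ is the set of all $f\in\mathrm{Op}(A)$ preserving all members of $T$, and $\mathrm{Pol}^{(d)}T$ its $d$-ary part. $\mathring\rho$ is the ordinary $|\alpha|$-ary relation obtained from an R-relation $\rho\subseteq A^\alpha$ via an arbitrary fixed bijection $|\alpha|\to\alpha$; $\mathring Q'=\{\mathring\rho\mid\rho\in Q'\}$, and $[\mathring M]$ means $[\{\mathring M\}]$. $[Q]_{\exists,\wedge,=}$ is the relational clone generated by $Q$, i.e. the set of all relations definable from $Q$ by primitive positive formulas (the empty relation being always included, so that $[Q]_{\exists,\wedge,=}=\mathrm{Inv}\,\mathrm{Pol}\,Q$, where $\mathrm{Inv}\,F$ is the set of relations in $\mathrm{Rel}(A)$ preserved by all $f\in F$). *)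

theory Defs
  imports HOL.Hull "HOL-Library.FuncSet" "HOL-Library.NList"
begin

text \<open>
  The power \<open>B\<^sup>n\<close> is \<open>nlists n B\<close>, the set of lists of length \<open>n\<close> over \<open>B\<close>, and functions
  between carrier sets are the extensional ones (\<open>\<rightarrow>\<^sub>E\<close>). Operations and relations are
  paired with their arity.
\<close>

type_synonym 'a op = "nat \<times> ('a list \<Rightarrow> 'a)"
type_synonym 'a frel = "nat \<times> 'a list set"

definition Op :: "'a set \<Rightarrow> 'a op set" where
  "Op A = {(n, f). n \<ge> 1 \<and> f \<in> nlists n A \<rightarrow>\<^sub>E A}"

definition Rel :: "'a set \<Rightarrow> 'a frel set" where
  "Rel A = {(m, \<rho>). m \<ge> 1 \<and> \<rho> \<subseteq> nlists m A}"

definition dary :: "nat \<Rightarrow> 'a op set \<Rightarrow> 'a op set" where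
  "dary d F = {p \<in> F. fst p = d}"

definition const_op :: "'a set \<Rightarrow> nat \<Rightarrow> 'a \<Rightarrow> 'a op" where
  "const_op A n c = (n, \<lambda>xs\<in>nlists n A. c)"

definition proj_op :: "'a set \<Rightarrow> nat \<Rightarrow> nat \<Rightarrow> 'a op" where
  "proj_op A n i = (n, \<lambda>xs\<in>nlists n A. xs ! i)"

definition comp_op :: "'a set \<Rightarrow> nat \<Rightarrow> ('a list \<Rightarrow> 'a) \<Rightarrow> ('a list \<Rightarrow> 'a) list \<Rightarrow> 'a op" where
  "comp_op A m f gs = (m, \<lambda>xs\<in>nlists m A. f (map (\<lambda>g. g xs) gs))"


section \<open>Clones and clone fragments\<close>

definition is_clone :: "'a set \<Rightarrow> 'a op set \<Rightarrow> bool" where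
  "is_clone A C \<longleftrightarrow>
     C \<subseteq> Op A \<and>
     (\<forall>n i. i < n \<longrightarrow> proj_op A n i \<in> C) \<and>
     (\<forall>n f m gs. (n, f) \<in> C \<and> length gs = n \<and> (\<forall>g\<in>set gs. (m, g) \<in> C)
        \<longrightarrow> comp_op A m f gs \<in> C)"

definition clone_gen :: "'a set \<Rightarrow> 'a op set \<Rightarrow> 'a op set" where
  "clone_gen A F = is_clone A hull F"

definition clone_fragment :: "'a set \<Rightarrow> nat \<Rightarrow> 'a op set \<Rightarrow> bool" where
  "clone_fragment A d M \<longleftrightarrow> M \<subseteq> dary d (Op A) \<and> M = dary d (clone_gen A M)"


section \<open>Translations\<close>

text \<open>
  A substitution pattern for an \<open>n\<close>-ary operation is a list of length \<open>n\<close>: \<open>Some c\<close> at a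
  position means that the constant \<open>c\<close> is substituted there, \<open>None\<close> that the variable is kept.
  \<open>fill p xs\<close> puts the entries of \<open>xs\<close>, in their order, in the places of the \<open>None\<close>s.
\<close>

fun fill :: "'a option list \<Rightarrow> 'a list \<Rightarrow> 'a list" where
  "fill [] xs = []"
| "fill (Some c # p) xs = c # fill p xs"
| "fill (None # p) xs = hd xs # fill p (tl xs)"

definition trl :: "'a set \<Rightarrow> nat \<Rightarrow> 'a op \<Rightarrow> 'a op set" where
  "trl A d = (\<lambda>(n, f).
     {(d, \<lambda>xs\<in>nlists d A. f (fill p (take t (drop u xs)))) | p u t v.
        length p = n \<and> (\<forall>c. Some c \<in> set p \<longrightarrow> c \<in> A) \<and>
        t = count_list p None \<and> u + t + v = d})"

definition star_op :: "'a set \<Rightarrow> nat \<Rightarrow> 'a op set \<Rightarrow> 'a op set" where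
  "star_op A d M = {p \<in> Op A. trl A d p \<subseteq> M}"


section \<open>Ordinary relations\<close>

definition preserves :: "'a op \<Rightarrow> 'a frel \<Rightarrow> bool" where
  "preserves = (\<lambda>(n, f) (m, \<rho>).
     \<forall>rs. length rs = n \<and> set rs \<subseteq> \<rho> \<longrightarrow> map (\<lambda>i. f (map (\<lambda>r. r ! i) rs)) [0..<m] \<in> \<rho>)"

definition Pol :: "'a set \<Rightarrow> 'a frel set \<Rightarrow> 'a op set" where
  "Pol A Q = {p \<in> Op A. \<forall>\<sigma>\<in>Q. preserves p \<sigma>}"

definition Xi :: "'a set \<Rightarrow> nat \<Rightarrow> 'a frel set \<Rightarrow> bool" where
  "Xi A d Q \<longleftrightarrow> Pol A Q = star_op A d (dary d (Pol A Q))"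

text \<open>
  Atoms of primitive positive formulas; a variable is a natural number, evaluated as a position
  in a list of values.
\<close>

datatype 'a pp_atom = EqAtom nat nat | RelAtom "'a frel" "nat list"

fun atom_wf :: "'a frel set \<Rightarrow> nat \<Rightarrow> 'a pp_atom \<Rightarrow> bool" where
  "atom_wf Q k (EqAtom i j) \<longleftrightarrow> i < k \<and> j < k"
| "atom_wf Q k (RelAtom \<sigma> is) \<longleftrightarrow> \<sigma> \<in> Q \<and> is \<in> nlists (fst \<sigma>) {..<k}"

fun atom_holds :: "'a list \<Rightarrow> 'a pp_atom \<Rightarrow> bool" where
  "atom_holds zs (EqAtom i j) \<longleftrightarrow> zs ! i = zs ! j"
| "atom_holds zs (RelAtom \<sigma> is) \<longleftrightarrow> map (\<lambda>i. zs ! i) is \<in> snd \<sigma>"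

text \<open>
  The relation defined by \<open>\<exists>x\<^sub>m \<dots> x\<^bsub>m+p-1\<^esub>. \<And>as\<close>, with free variables \<open>x\<^sub>0, \<dots>, x\<^bsub>m-1\<^esub>\<close>.
\<close>

definition pp_rel :: "'a set \<Rightarrow> nat \<Rightarrow> nat \<Rightarrow> 'a pp_atom list \<Rightarrow> 'a frel" where
  "pp_rel A m p as =
     (m, {xs \<in> nlists m A. \<exists>ys\<in>nlists p A. \<forall>a\<in>set as. atom_holds (xs @ ys) a})"

text \<open>
  Since arities are recorded, there is one empty relation for every arity.
\<close>

definition rel_clone :: "'a set \<Rightarrow> 'a frel set \<Rightarrow> 'a frel set" where
  "rel_clone A Q =
     {pp_rel A m p as | m p as. m \<ge> 1 \<and> (\<forall>a\<in>set as. atom_wf Q (m + p) a)}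
     \<union> {(m, {}) | m. m \<ge> 1}"


section \<open>R-relations of simple arity\<close>

definition insert_nth :: "nat \<Rightarrow> 'b \<Rightarrow> 'b list \<Rightarrow> 'b list" where
  "insert_nth i c xs = take i xs @ c # drop i xs"

definition ebtrl :: "'b set \<Rightarrow> nat \<Rightarrow> ('b list \<Rightarrow> 'v) \<Rightarrow> ('b list \<Rightarrow> 'v) set" where
  "ebtrl B n h = {(\<lambda>xs\<in>nlists n B. h (insert_nth i c xs)) | i c. i \<le> n \<and> c \<in> B}"

definition eftrl :: "'b set \<Rightarrow> nat \<Rightarrow> ('b list \<Rightarrow> 'v) \<Rightarrow> ('b list \<Rightarrow> 'v) set" where
  "eftrl B n g = {(\<lambda>xs\<in>nlists (Suc n) B. g (tl xs)), (\<lambda>xs\<in>nlists (Suc n) B. g (butlast xs))}"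

definition circled_star :: "'b set \<Rightarrow> nat \<Rightarrow> 'v set \<Rightarrow> ('b list \<Rightarrow> 'v) set \<Rightarrow> ('b list \<Rightarrow> 'v) set" where
  "circled_star B d V \<rho> = {h \<in> nlists (Suc d) B \<rightarrow>\<^sub>E V. ebtrl B d h \<subseteq> \<rho>}"

definition Delta :: "'b set \<Rightarrow> nat \<Rightarrow> ('b list \<Rightarrow> 'v) \<Rightarrow> ('b list \<Rightarrow> 'v) set" where
  "Delta B d h = {(\<lambda>xs\<in>nlists d B. h (insert_nth j (xs ! i) xs)) | i j. i < j \<and> j \<le> d}"

definition simple_int_reflexive :: "'b set \<Rightarrow> nat \<Rightarrow> 'v set \<Rightarrow> ('b list \<Rightarrow> 'v) set \<Rightarrow> bool" where
  "simple_int_reflexive B d V \<rho> \<longleftrightarrow> (\<Union>g\<in>\<rho>. eftrl B d g) \<subseteq> circled_star B d V \<rho>"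

definition simple_transitive :: "'b set \<Rightarrow> nat \<Rightarrow> 'v set \<Rightarrow> ('b list \<Rightarrow> 'v) set \<Rightarrow> bool" where
  "simple_transitive B d V \<rho> \<longleftrightarrow> (\<Union>h\<in>circled_star B d V \<rho>. Delta B d h) \<subseteq> \<rho>"


section \<open>R-relations of arbitrary arity\<close>

text \<open>
  An arity \<open>B\<^sub>1\<^bsup>d\<^sub>1\<^esup> \<times> \<dots> \<times> B\<^sub>s\<^bsup>d\<^sub>s\<^esup>\<close> is encoded as the list of the pairs \<open>(B\<^sub>j, d\<^sub>j)\<close> (indexed from
  \<open>0\<close>), and an element \<open>(X\<^sub>1, \<dots>, X\<^sub>s)\<close> of it as a list of lists. An R-relation is paired with
  its arity.
\<close>

type_synonym 'b arity = "('b set \<times> nat) list"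
type_synonym ('a, 'b) rrel = "'b arity \<times> ('b list list \<Rightarrow> 'a) set"

definition box :: "'b arity \<Rightarrow> 'b list list set" where
  "box \<alpha> = listset (map (\<lambda>(B, d). nlists d B) \<alpha>)"

definition dimension :: "'b arity \<Rightarrow> nat" where
  "dimension \<alpha> = sum_list (map snd \<alpha>)"

definition delete_nth :: "nat \<Rightarrow> 'b list \<Rightarrow> 'b list" where
  "delete_nth j xs = take j xs @ drop (Suc j) xs"

definition curry_at ::
    "'b arity \<Rightarrow> nat \<Rightarrow> ('b list list \<Rightarrow> 'a) \<Rightarrow> 'b list \<Rightarrow> 'b list list \<Rightarrow> 'a" where
  "curry_at \<alpha> j g =
     (\<lambda>X\<in>nlists (snd (\<alpha> ! j)) (fst (\<alpha> ! j)). \<lambda>Y\<in>box (delete_nth j \<alpha>). g (insert_nth j X Y))"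

definition int_reflexive :: "'a set \<Rightarrow> ('a, 'b) rrel \<Rightarrow> bool" where
  "int_reflexive A = (\<lambda>(\<alpha>, \<rho>). \<forall>j<length \<alpha>.
     simple_int_reflexive (fst (\<alpha> ! j)) (snd (\<alpha> ! j)) (box (delete_nth j \<alpha>) \<rightarrow>\<^sub>E A)
       (curry_at \<alpha> j ` \<rho>))"

definition transitive :: "'a set \<Rightarrow> ('a, 'b) rrel \<Rightarrow> bool" where
  "transitive A = (\<lambda>(\<alpha>, \<rho>). \<forall>j<length \<alpha>.
     simple_transitive (fst (\<alpha> ! j)) (snd (\<alpha> ! j)) (box (delete_nth j \<alpha>) \<rightarrow>\<^sub>E A)
       (curry_at \<alpha> j ` \<rho>))"

definition gen_quasiorder :: "'a set \<Rightarrow> ('a, 'b) rrel \<Rightarrow> bool" where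
  "gen_quasiorder A = (\<lambda>(\<alpha>, \<rho>).
     \<rho> \<subseteq> (box \<alpha> \<rightarrow>\<^sub>E A) \<and> int_reflexive A (\<alpha>, \<rho>) \<and> transitive A (\<alpha>, \<rho>) \<and>
     (\<forall>c\<in>A. (\<lambda>X\<in>box \<alpha>. c) \<in> \<rho>))"

definition canonical_arity :: "nat arity \<Rightarrow> bool" where
  "canonical_arity \<alpha> \<longleftrightarrow> \<alpha> \<noteq> [] \<and> (\<forall>(B, d)\<in>set \<alpha>. d \<ge> 1 \<and> (\<exists>m\<ge>1. B = {..<m}))"

definition GQuord :: "nat \<Rightarrow> 'a set \<Rightarrow> ('a, nat) rrel set" where
  "GQuord d A =
     {(\<alpha>, \<rho>). canonical_arity \<alpha> \<and> dimension \<alpha> = d \<and> gen_quasiorder A (\<alpha>, \<rho>)}"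

definition preserves_rrel :: "'a op \<Rightarrow> ('a, 'b) rrel \<Rightarrow> bool" where
  "preserves_rrel = (\<lambda>(n, f) (\<alpha>, \<rho>).
     \<forall>gs. length gs = n \<and> set gs \<subseteq> \<rho> \<longrightarrow> (\<lambda>X\<in>box \<alpha>. f (map (\<lambda>g. g X) gs)) \<in> \<rho>)"

definition Pol_rrel :: "'a set \<Rightarrow> ('a, 'b) rrel set \<Rightarrow> 'a op set" where
  "Pol_rrel A Q = {p \<in> Op A. \<forall>\<sigma>\<in>Q. preserves_rrel p \<sigma>}"

text \<open>
  The ordinary relation obtained from an R-relation; \<open>en \<alpha>\<close> is meant to be a bijection from
  \<open>{..<card (box \<alpha>)}\<close> to \<open>box \<alpha>\<close>.
\<close>

definition ring_rel :: "('b arity \<Rightarrow> nat \<Rightarrow> 'b list list) \<Rightarrow> ('a, 'b) rrel \<Rightarrow> 'a frel" where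
  "ring_rel en = (\<lambda>(\<alpha>, \<rho>).
     (card (box \<alpha>), {map (\<lambda>i. g (en \<alpha> i)) [0..<card (box \<alpha>)] | g. g \<in> \<rho>}))"

text \<open>
  A set of \<open>d\<close>-ary operations on \<open>A\<close> as an R-relation of simple arity \<open>A\<^sup>d\<close>, where \<open>A\<close> is
  identified with the ordinal \<open>card A\<close> by the bijection \<open>e\<close> from \<open>{..<card A}\<close> to \<open>A\<close>.
\<close>

definition ops_rrel :: "(nat \<Rightarrow> 'a) \<Rightarrow> 'a set \<Rightarrow> nat \<Rightarrow> 'a op set \<Rightarrow> ('a, nat) rrel" where
  "ops_rrel e A d M =
     (let \<alpha> = [({..<card A}, d)]
      in (\<alpha>, {(\<lambda>X\<in>box \<alpha>. f (map e (hd X))) | f. (d, f) \<in> M}))"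

end

(*
  Since rel_clone A Q consists of the relations invariant under Pol A Q, conditions (ii) and (ii)'
  agree. If Xi holds, M = dary d (Pol A Q) contains the constants (translate the identity); for an
  operation H of arity d + 1 whose sections by constants are in M, all translations of H are
  in M, so H is in Pol A Q by Xi. This is transitivity of M, and M generates the same clone.

  Conversely, let \<rho> be a generalized quasiorder of arity B_1^(d_1) x ... x B_s^(d_s) with
  d_1 + ... + d_s = d, let all d-ary translations of f preserve \<rho>, and let g_1, ..., g_n be in \<rho>.
  Give each g_i its own variables: h = f (g_1 (Y_1), ..., g_n (Y_n)) has n d_j variables of sort B_j.
  If constants are substituted for all but d_j variables of each sort, then at most d of the
  g_i still depend on a variable, the others become constants, and those that remain are in \<rho> by
  internal reflexivity; so the result is in \<rho>, because it is a translation of f applied to members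
  of \<rho>. By transitivity this property of h survives identifying the last variable of a sort with an
  earlier one. Identifying cyclically until d_j variables are left, one arrives at f (g_1, ..., g_n).
*)

theory Submission
  imports Defs
begin

text \<open>
  As conditional rewrite rules these have the set \<open>A\<close> free in the premise, which makes \<open>simp\<close> loop.
\<close>

declare nlistsE_length [simp del] nlistsE_set [simp del]

text \<open>Transitivity speaks only of functions with one variable more than the arity, whereas
  \<open>f (g_1 (X), ..., g_n (X))\<close> has no variable to spare. Separating the variables
  creates the room. Every kept variable then lies in a single block, and their total number is the
  dimension d; so at most d arguments of f are not constant, and this count is where the dimension
  enters. Internal reflexivity covers the remaining arguments because the kept variables occur in
  their order: those in one block form an interval of the d_j kept ones, surrounded by fictitious
  variables, as in the definition of translations. The cyclic order of identification makes variable
  l of sort j equal to variable l modulo d_j, so each block ends as a copy of the original tuple.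
  For an operation H of arity d + 1 the corresponding count is that a translation keeps at most d
  variables, hence substitutes a constant somewhere and factors through a section of H. That M
  determines the whole clone is due to the fact that translations are compositions with projections
  and constants, all of which belong to M.\<close>

lemma in_nlists_iff: "xs \<in> nlists n B \<longleftrightarrow> length xs = n \<and> set xs \<subseteq> B"
  by (simp add: nlists_def)


section \<open>R-relations without currying\<close>

lemma in_listset_iff:
  "X \<in> listset As \<longleftrightarrow> length X = length As \<and> (\<forall>i<length As. X ! i \<in> As ! i)"
proof (induction As arbitrary: X)
  case (Cons A As)
  show ?case
  proof (cases X)
    case (Cons x Xs)
    then show ?thesis
      using Cons.IH[of Xs] by (auto simp: set_Cons_def nth_Cons' less_Suc_eq_0_disj)
  qed (simp add: set_Cons_def)
qed simp

lemma in_box_iff: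
  "X \<in> box \<alpha> \<longleftrightarrow>
     length X = length \<alpha> \<and> (\<forall>j<length \<alpha>. X ! j \<in> nlists (snd (\<alpha> ! j)) (fst (\<alpha> ! j)))"
  by (auto simp: box_def in_listset_iff case_prod_beta)

lemma length_delete_nth: "j < length xs \<Longrightarrow> length (delete_nth j xs) = length xs - 1"
  by (auto simp: delete_nth_def min_def)

lemma nth_delete_nth:
  "j < length xs \<Longrightarrow> i < length xs - 1 \<Longrightarrow>
     delete_nth j xs ! i = (if i < j then xs ! i else xs ! Suc i)"
  by (auto simp: delete_nth_def nth_append min_def)

lemma length_insert_nth [simp]: "length (insert_nth i c xs) = Suc (length xs)"
  by (auto simp: insert_nth_def min_def)

lemma set_insert_nth [simp]: "set (insert_nth i c xs) = insert c (set xs)"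
  unfolding insert_nth_def
  by (metis Un_insert_right append_take_drop_id list.simps(15) set_append)

lemma nth_insert_nth:
  "j \<le> length xs \<Longrightarrow> i \<le> length xs \<Longrightarrow>
     insert_nth j x xs ! i = (if i < j then xs ! i else if i = j then x else xs ! (i - 1))"
  by (auto simp: insert_nth_def nth_append nth_Cons' min_def)

lemma insert_nth_delete_nth: "j < length xs \<Longrightarrow> insert_nth j (xs ! j) (delete_nth j xs) = xs"
  using id_take_nth_drop[of j xs] by (simp add: insert_nth_def delete_nth_def)

lemma delete_nth_insert_nth: "j \<le> length xs \<Longrightarrow> delete_nth j (insert_nth j x xs) = xs"
  by (simp add: insert_nth_def delete_nth_def)

lemma list_update_insert_nth:
  "j \<le> length xs \<Longrightarrow> (insert_nth j x xs)[j := y] = insert_nth j y xs"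
  by (simp add: insert_nth_def list_update_append)

lemma insert_nth_in_nlists:
  "xs \<in> nlists n B \<Longrightarrow> c \<in> B \<Longrightarrow> insert_nth i c xs \<in> nlists (Suc n) B"
  by (auto simp: in_nlists_iff)

lemma tl_in_nlists: "xs \<in> nlists (Suc n) B \<Longrightarrow> tl xs \<in> nlists n B"
  by (cases xs) (auto simp: in_nlists_iff)

lemma butlast_in_nlists: "xs \<in> nlists (Suc n) B \<Longrightarrow> butlast xs \<in> nlists n B"
  by (auto simp: in_nlists_iff dest: in_set_butlastD)

lemma insert_nth_in_box_iff:
  assumes "j < length \<alpha>" and "Y \<in> box (delete_nth j \<alpha>)"
  shows "insert_nth j x Y \<in> box \<alpha> \<longleftrightarrow> x \<in> nlists (snd (\<alpha> ! j)) (fst (\<alpha> ! j))"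
proof -
  have len: "length Y = length \<alpha> - 1"
    using assms by (simp add: in_box_iff length_delete_nth)
  have nth: "Y ! i \<in> nlists (snd (delete_nth j \<alpha> ! i)) (fst (delete_nth j \<alpha> ! i))"
    if "i < length \<alpha> - 1" for i
    using assms that by (simp add: in_box_iff length_delete_nth)
  have eq: "insert_nth j x Y ! i = (if i < j then Y ! i else if i = j then x else Y ! (i - 1))"
    if "i < length \<alpha>" for i
    using that assms(1) len by (intro nth_insert_nth) auto
  have "insert_nth j x Y ! i \<in> nlists (snd (\<alpha> ! i)) (fst (\<alpha> ! i))"
    if "i < length \<alpha>" "i \<noteq> j" for i
  proof (cases "i < j")
    case True
    then show ?thesis
      using nth[of i] that assms(1) eq[of i] by (simp add: nth_delete_nth)
  next
    case False
    with that obtain i' where i': "i = Suc i'"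
      by (cases i) auto
    then show ?thesis
      using nth[of i'] that False assms(1) eq[of i] by (simp add: nth_delete_nth)
  qed
  then have "insert_nth j x Y \<in> box \<alpha> \<longleftrightarrow>
      insert_nth j x Y ! j \<in> nlists (snd (\<alpha> ! j)) (fst (\<alpha> ! j))"
    using assms(1) len unfolding in_box_iff by (metis Suc_diff_1 length_insert_nth less_nat_zero_code neq0_conv)
  then show ?thesis
    using eq[OF assms(1)] by simp
qed

lemma delete_nth_in_box:
  assumes "j < length \<alpha>" and "X \<in> box \<alpha>"
  shows "delete_nth j X \<in> box (delete_nth j \<alpha>)"
  using assms by (auto simp: in_box_iff length_delete_nth nth_delete_nth)

lemma list_update_in_box:
  assumes "X \<in> box \<alpha>" and "j < length \<alpha> \<Longrightarrow> x \<in> nlists (snd (\<alpha> ! j)) (fst (\<alpha> ! j))"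
  shows "X[j := x] \<in> box \<alpha>"
proof -
  have "X[j := x] ! i \<in> nlists (snd (\<alpha> ! i)) (fst (\<alpha> ! i))" if "i < length \<alpha>" for i
    using assms that by (cases "i = j") (auto simp: in_box_iff)
  then show ?thesis
    using assms(1) by (simp add: in_box_iff)
qed

lemma length_of_box: "X \<in> box \<alpha> \<Longrightarrow> length X = length \<alpha>"
  by (simp add: in_box_iff)

lemma length_of_box_delete_nth:
  "j < length \<alpha> \<Longrightarrow> Y \<in> box (delete_nth j \<alpha>) \<Longrightarrow> j \<le> length Y"
  by (simp add: in_box_iff length_delete_nth)

section \<open>Currying one coordinate and substituting into it\<close>

lemma curry_at_restrict:
  assumes "j < length \<alpha>"
  shows "curry_at \<alpha> j (\<lambda>X\<in>box \<alpha>. F X) =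
    (\<lambda>x\<in>nlists (snd (\<alpha> ! j)) (fst (\<alpha> ! j)). \<lambda>Y\<in>box (delete_nth j \<alpha>). F (insert_nth j x Y))"
  unfolding curry_at_def
  by (intro restrict_ext) (simp add: insert_nth_in_box_iff assms)

lemma inj_on_curry_at:
  assumes "j < length \<alpha>"
  shows "inj_on (curry_at \<alpha> j) (box \<alpha> \<rightarrow>\<^sub>E V)"
proof (rule inj_onI)
  fix g h assume g: "g \<in> box \<alpha> \<rightarrow>\<^sub>E V" and h: "h \<in> box \<alpha> \<rightarrow>\<^sub>E V"
    and eq: "curry_at \<alpha> j g = curry_at \<alpha> j h"
  show "g = h"
  proof (rule extensionalityI)
    fix X assume X: "X \<in> box \<alpha>"
    have "X ! j \<in> nlists (snd (\<alpha> ! j)) (fst (\<alpha> ! j))" "delete_nth j X \<in> box (delete_nth j \<alpha>)"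
      using X assms by (auto simp: in_box_iff[of X] delete_nth_in_box)
    moreover have "insert_nth j (X ! j) (delete_nth j X) = X"
      using X assms by (simp add: insert_nth_delete_nth length_of_box)
    ultimately show "g X = h X"
      using fun_cong[OF fun_cong[OF eq, of "X ! j"], of "delete_nth j X"]
      by (simp add: curry_at_def)
  qed (use g h in \<open>auto simp: PiE_def\<close>)
qed

lemma curry_at_mem_iff:
  assumes "j < length \<alpha>" and "\<rho> \<subseteq> box \<alpha> \<rightarrow>\<^sub>E V" and "g \<in> box \<alpha> \<rightarrow>\<^sub>E V"
  shows "curry_at \<alpha> j g \<in> curry_at \<alpha> j ` \<rho> \<longleftrightarrow> g \<in> \<rho>"
  using inj_on_image_mem_iff[OF inj_on_curry_at[OF assms(1)] assms(3,2)] .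

lemma curry_at_PiE:
  assumes "j < length \<alpha>" and "g \<in> box \<alpha> \<rightarrow>\<^sub>E V"
  shows "curry_at \<alpha> j g \<in> nlists (snd (\<alpha> ! j)) (fst (\<alpha> ! j)) \<rightarrow>\<^sub>E (box (delete_nth j \<alpha>) \<rightarrow>\<^sub>E V)"
  using assms by (auto simp: curry_at_def insert_nth_in_box_iff intro!: PiE_I)

text \<open>Precomposition in one coordinate is the common form of \<open>ebtrl\<close>,
  \<open>eftrl\<close> and \<open>Delta\<close>. The map \<open>\<phi>\<close> may change the length
  of the list: no arity of \<open>g\<close> is recorded, so \<open>g\<close> may have one variable
  more in the coordinate \<open>j\<close>.\<close>

definition subst_at :: "'b arity \<Rightarrow> nat \<Rightarrow> ('b list \<Rightarrow> 'b list) \<Rightarrow> ('b list list \<Rightarrow> 'a)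
    \<Rightarrow> 'b list list \<Rightarrow> 'a" where
  "subst_at \<alpha> j \<phi> g = (\<lambda>X\<in>box \<alpha>. g (X[j := \<phi> (X ! j)]))"

lemma curry_at_subst_at:
  assumes "j < length \<alpha>"
  shows "curry_at \<alpha> j (subst_at \<alpha> j \<phi> g) =
    (\<lambda>x\<in>nlists (snd (\<alpha> ! j)) (fst (\<alpha> ! j)). \<lambda>Y\<in>box (delete_nth j \<alpha>). g (insert_nth j (\<phi> x) Y))"
  unfolding subst_at_def curry_at_restrict[OF assms]
  using length_of_box_delete_nth[OF assms]
  by (intro restrict_ext) (simp add: list_update_insert_nth nth_insert_nth)

text \<open>Adding a fictitious variable and then substituting a constant is the same as inserting
  the constant and dropping the first or the last entry. Injectivity of currying removes the curried
  form.\<close>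

lemma int_reflexive_iff:
  assumes sub: "\<rho> \<subseteq> box \<alpha> \<rightarrow>\<^sub>E A"
  shows "int_reflexive A (\<alpha>, \<rho>) \<longleftrightarrow>
    (\<forall>j<length \<alpha>. \<forall>g\<in>\<rho>. \<forall>i\<le>snd (\<alpha> ! j). \<forall>c\<in>fst (\<alpha> ! j).
       subst_at \<alpha> j (\<lambda>x. tl (insert_nth i c x)) g \<in> \<rho> \<and>
       subst_at \<alpha> j (\<lambda>x. butlast (insert_nth i c x)) g \<in> \<rho>)"
proof -
  have "simple_int_reflexive B k (box (delete_nth j \<alpha>) \<rightarrow>\<^sub>E A) (curry_at \<alpha> j ` \<rho>) \<longleftrightarrow>
    (\<forall>g\<in>\<rho>. \<forall>i\<le>k. \<forall>c\<in>B.
       subst_at \<alpha> j (\<lambda>x. tl (insert_nth i c x)) g \<in> \<rho> \<and>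
       subst_at \<alpha> j (\<lambda>x. butlast (insert_nth i c x)) g \<in> \<rho>)"
    if j: "j < length \<alpha>" and B: "B = fst (\<alpha> ! j)" and k: "k = snd (\<alpha> ! j)" for j B k
  proof -
    \<comment> \<open>The map \<open>t\<close> stands for \<open>tl\<close> and
      \<open>butlast\<close>, the two cases of \<open>eftrl\<close>.\<close>
    have trunc: "(\<lambda>xs\<in>nlists (Suc k) B. curry_at \<alpha> j g (t xs)) \<in>
          circled_star B k (box (delete_nth j \<alpha>) \<rightarrow>\<^sub>E A) (curry_at \<alpha> j ` \<rho>) \<longleftrightarrow>
        (\<forall>i\<le>k. \<forall>c\<in>B. subst_at \<alpha> j (\<lambda>x. t (insert_nth i c x)) g \<in> \<rho>)"
      if g: "g \<in> \<rho>" and t: "\<And>xs. xs \<in> nlists (Suc k) B \<Longrightarrow> t xs \<in> nlists k B" for g t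
    proof -
      have ext: "(\<lambda>xs\<in>nlists (Suc k) B. curry_at \<alpha> j g (t xs)) \<in>
          nlists (Suc k) B \<rightarrow>\<^sub>E (box (delete_nth j \<alpha>) \<rightarrow>\<^sub>E A)"
        using curry_at_PiE[OF j, of g A] g sub t unfolding B k by (intro PiE_I) auto
      have eq: "(\<lambda>xs\<in>nlists k B. (\<lambda>xs\<in>nlists (Suc k) B. curry_at \<alpha> j g (t xs)) (insert_nth i c xs))
          = curry_at \<alpha> j (subst_at \<alpha> j (\<lambda>x. t (insert_nth i c x)) g)"
        if "c \<in> B" for i c
        unfolding curry_at_subst_at[OF j] B[symmetric] k[symmetric]
        using insert_nth_in_nlists[OF _ that] t
        by (intro restrict_ext) (simp add: curry_at_def B[symmetric] k[symmetric])
      have "subst_at \<alpha> j (\<lambda>x. t (insert_nth i c x)) g \<in> box \<alpha> \<rightarrow>\<^sub>E A" if "c \<in> B" for i c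
      proof -
        have "X[j := t (insert_nth i c (X ! j))] \<in> box \<alpha>" if "X \<in> box \<alpha>" for X
          using t insert_nth_in_nlists[OF _ \<open>c \<in> B\<close>] that j unfolding B k
          by (intro list_update_in_box) (auto simp: in_box_iff)
        then show ?thesis
          using g sub unfolding subst_at_def by (intro PiE_I) auto
      qed
      then have mem: "curry_at \<alpha> j (subst_at \<alpha> j (\<lambda>x. t (insert_nth i c x)) g) \<in> curry_at \<alpha> j ` \<rho> \<longleftrightarrow>
          subst_at \<alpha> j (\<lambda>x. t (insert_nth i c x)) g \<in> \<rho>" if "c \<in> B" for i c
        using curry_at_mem_iff[OF j sub] that by blast
      have "ebtrl B k (\<lambda>xs\<in>nlists (Suc k) B. curry_at \<alpha> j g (t xs)) \<subseteq> curry_at \<alpha> j ` \<rho> \<longleftrightarrow>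
          (\<forall>i\<le>k. \<forall>c\<in>B. (\<lambda>xs\<in>nlists k B. (\<lambda>xs\<in>nlists (Suc k) B. curry_at \<alpha> j g (t xs))
             (insert_nth i c xs)) \<in> curry_at \<alpha> j ` \<rho>)"
        unfolding ebtrl_def by blast
      also have "\<dots> \<longleftrightarrow> (\<forall>i\<le>k. \<forall>c\<in>B. subst_at \<alpha> j (\<lambda>x. t (insert_nth i c x)) g \<in> \<rho>)"
        by (intro all_cong ball_cong refl) (simp only: eq mem)
      finally show ?thesis
        using ext by (simp add: circled_star_def)
    qed
    show ?thesis
      unfolding simple_int_reflexive_def eftrl_def
      using trunc[OF _ tl_in_nlists] trunc[OF _ butlast_in_nlists]
      by (simp add: UN_subset_iff) blast
  qed
  then show ?thesis
    by (auto simp: int_reflexive_def)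
qed

text \<open>No condition on the values of \<open>H\<close> is required: only arguments with one
  entry more in the coordinate \<open>j\<close> matter, and there the values lie in \<open>A\<close>
  as soon as the sections lie in \<open>\<rho>\<close>.\<close>

lemma transitive_iff:
  fixes \<alpha> :: "'b arity" and \<rho> :: "('b list list \<Rightarrow> 'a) set"
  assumes sub: "\<rho> \<subseteq> box \<alpha> \<rightarrow>\<^sub>E A"
  shows "transitive A (\<alpha>, \<rho>) \<longleftrightarrow>
    (\<forall>j<length \<alpha>. \<forall>H.
       (\<forall>i\<le>snd (\<alpha> ! j). \<forall>c\<in>fst (\<alpha> ! j). subst_at \<alpha> j (insert_nth i c) H \<in> \<rho>) \<longrightarrow>
       (\<forall>l\<le>snd (\<alpha> ! j). \<forall>i<l. subst_at \<alpha> j (\<lambda>x. insert_nth l (x ! i) x) H \<in> \<rho>))"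
proof -
  have "simple_transitive B k (box (delete_nth j \<alpha>) \<rightarrow>\<^sub>E A) (curry_at \<alpha> j ` \<rho>) \<longleftrightarrow>
    (\<forall>H. (\<forall>i\<le>k. \<forall>c\<in>B. subst_at \<alpha> j (insert_nth i c) H \<in> \<rho>) \<longrightarrow>
       (\<forall>l\<le>k. \<forall>i<l. subst_at \<alpha> j (\<lambda>x. insert_nth l (x ! i) x) H \<in> \<rho>))"
    (is "?L \<longleftrightarrow> ?R")
    if j: "j < length \<alpha>" and B: "B = fst (\<alpha> ! j)" and k: "k = snd (\<alpha> ! j)" for j B k
  proof -
    let ?V = "box (delete_nth j \<alpha>) \<rightarrow>\<^sub>E A"
    \<comment> \<open>\<open>U H\<close> is \<open>H\<close> curried in the coordinate
      \<open>j\<close> with exponent \<open>Suc k\<close> there; \<open>curry_at \<alpha>\<close>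
      would use the exponent \<open>k\<close>.\<close>
    define U where "U H = (\<lambda>x\<in>nlists (Suc k) B. \<lambda>Y\<in>box (delete_nth j \<alpha>). H (insert_nth j x Y))"
      for H :: "'b list list \<Rightarrow> 'a"
    have eq: "(\<lambda>xs\<in>nlists k B. U H (\<psi> xs)) = curry_at \<alpha> j (subst_at \<alpha> j \<psi> H)"
      if "\<And>xs. xs \<in> nlists k B \<Longrightarrow> \<psi> xs \<in> nlists (Suc k) B" for H \<psi>
      unfolding curry_at_subst_at[OF j] B[symmetric] k[symmetric] U_def
      using that by (intro restrict_ext) simp
    have decomp: "xs \<in> nlists (Suc k) B \<Longrightarrow> \<exists>c\<in>B. \<exists>ys\<in>nlists k B. xs = insert_nth 0 c ys" for xs
      by (cases xs) (auto simp: in_nlists_iff insert_nth_def)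
    \<comment> \<open>A list of length \<open>Suc k\<close> begins with some \<open>c\<close> in
      \<open>B\<close>, so the value is one of the section that inserts \<open>c\<close> at position
      0.\<close>
    have ext: "H (insert_nth j x Y) \<in> A"
      if H: "\<And>c. c \<in> B \<Longrightarrow> curry_at \<alpha> j (subst_at \<alpha> j (insert_nth 0 c) H) \<in> curry_at \<alpha> j ` \<rho>"
        and x: "x \<in> nlists (Suc k) B" and Y: "Y \<in> box (delete_nth j \<alpha>)" for H x Y
    proof -
      obtain c ys where c: "c \<in> B" and ys: "ys \<in> nlists k B" and xeq: "x = insert_nth 0 c ys"
        using decomp[OF x] by blast
      obtain g where "g \<in> \<rho>" and g: "curry_at \<alpha> j (subst_at \<alpha> j (insert_nth 0 c) H) = curry_at \<alpha> j g"
        using H[OF c] by blast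
      then have "g \<in> box \<alpha> \<rightarrow>\<^sub>E A"
        using sub by blast
      then have "curry_at \<alpha> j (subst_at \<alpha> j (insert_nth 0 c) H) \<in> nlists k B \<rightarrow>\<^sub>E ?V"
        unfolding g B k by (rule curry_at_PiE[OF j])
      then have "curry_at \<alpha> j (subst_at \<alpha> j (insert_nth 0 c) H) ys Y \<in> A"
        using ys Y by (auto simp: PiE_iff)
      then show ?thesis
        using ys Y xeq by (simp add: curry_at_subst_at[OF j] B[symmetric] k[symmetric])
    qed
    have ins: "insert_nth i c xs \<in> nlists (Suc k) B" if "xs \<in> nlists k B" "c \<in> B" for i c xs
      using that by (rule insert_nth_in_nlists)
    have dup: "insert_nth l (xs ! i) xs \<in> nlists (Suc k) B" if "xs \<in> nlists k B" "i < l" "l \<le> k"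
      for i l xs
      using that by (intro insert_nth_in_nlists) (auto simp: in_nlists_iff)
    have eq_dup: "(\<lambda>xs\<in>nlists k B. U H (insert_nth l (xs ! i) xs)) =
        curry_at \<alpha> j (subst_at \<alpha> j (\<lambda>x. insert_nth l (x ! i) x) H)" if "i < l" "l \<le> k" for H i l
      using dup[OF _ that] by (intro eq)
    have subst_ext: "subst_at \<alpha> j \<psi> H \<in> box \<alpha> \<rightarrow>\<^sub>E A"
      if H: "\<And>x Y. x \<in> nlists (Suc k) B \<Longrightarrow> Y \<in> box (delete_nth j \<alpha>) \<Longrightarrow> H (insert_nth j x Y) \<in> A"
        and \<psi>: "\<And>xs. xs \<in> nlists k B \<Longrightarrow> \<psi> xs \<in> nlists (Suc k) B" for H \<psi>
    proof -
      have "H (X[j := \<psi> (X ! j)]) \<in> A" if X: "X \<in> box \<alpha>" for X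
      proof -
        have "X[j := \<psi> (X ! j)] = insert_nth j (\<psi> (X ! j)) (delete_nth j X)"
          using X j list_update_insert_nth[of j "delete_nth j X" "X ! j" "\<psi> (X ! j)"]
          by (simp add: insert_nth_delete_nth length_of_box length_delete_nth)
        moreover have "X ! j \<in> nlists k B"
          using X j by (simp add: in_box_iff B k)
        ultimately show ?thesis
          using H[OF \<psi>] delete_nth_in_box[OF j X] by simp
      qed
      then show ?thesis
        unfolding subst_at_def by (intro PiE_I) auto
    qed
    show ?thesis
    proof
      assume L: ?L
      show ?R
      proof (intro allI impI)
        fix H l i
        assume H: "\<forall>i\<le>k. \<forall>c\<in>B. subst_at \<alpha> j (insert_nth i c) H \<in> \<rho>" and "l \<le> k" "i < l"
        have HA: "H (insert_nth j x Y) \<in> A"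
          if "x \<in> nlists (Suc k) B" "Y \<in> box (delete_nth j \<alpha>)" for x Y
          using ext[OF _ that] H by blast
        have "U H \<in> circled_star B k ?V (curry_at \<alpha> j ` \<rho>)"
          unfolding circled_star_def
        proof (intro CollectI conjI)
          show "U H \<in> nlists (Suc k) B \<rightarrow>\<^sub>E ?V"
            using HA unfolding U_def by (intro PiE_I) auto
          show "ebtrl B k (U H) \<subseteq> curry_at \<alpha> j ` \<rho>"
            using H eq[OF ins] unfolding ebtrl_def by auto
        qed
        moreover have "curry_at \<alpha> j (subst_at \<alpha> j (\<lambda>x. insert_nth l (x ! i) x) H) \<in> Delta B k (U H)"
          unfolding Delta_def using eq_dup[OF \<open>i < l\<close> \<open>l \<le> k\<close>, symmetric] \<open>i < l\<close> \<open>l \<le> k\<close> by auto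
        ultimately have "curry_at \<alpha> j (subst_at \<alpha> j (\<lambda>x. insert_nth l (x ! i) x) H) \<in> curry_at \<alpha> j ` \<rho>"
          using L unfolding simple_transitive_def by blast
        moreover have "subst_at \<alpha> j (\<lambda>x. insert_nth l (x ! i) x) H \<in> box \<alpha> \<rightarrow>\<^sub>E A"
          using HA dup[OF _ \<open>i < l\<close> \<open>l \<le> k\<close>] by (intro subst_ext)
        ultimately show "subst_at \<alpha> j (\<lambda>x. insert_nth l (x ! i) x) H \<in> \<rho>"
          using curry_at_mem_iff[OF j sub] by blast
      qed
    next
      assume R: ?R
      show ?L
        unfolding simple_transitive_def
      proof (intro UN_least subsetI)
        fix h h' assume h: "h \<in> circled_star B k ?V (curry_at \<alpha> j ` \<rho>)" and "h' \<in> Delta B k h"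
        then obtain i l where il: "i < l" "l \<le> k"
          and h': "h' = (\<lambda>xs\<in>nlists k B. h (insert_nth l (xs ! i) xs))"
          by (auto simp: Delta_def)
        \<comment> \<open>The uncurried form of \<open>h\<close>, for which
          \<open>U H = h\<close>.\<close>
        define H where "H X = h (X ! j) (delete_nth j X)" for X
        have hPi: "h \<in> nlists (Suc k) B \<rightarrow>\<^sub>E ?V" and heb: "ebtrl B k h \<subseteq> curry_at \<alpha> j ` \<rho>"
          using h by (auto simp: circled_star_def)
        have hV: "h x \<in> ?V" if "x \<in> nlists (Suc k) B" for x
          using hPi that by (auto simp: PiE_iff)
        have UH: "U H = h"
        proof (rule extensionalityI)
          fix x assume x: "x \<in> nlists (Suc k) B"
          show "U H x = h x"
          proof (rule extensionalityI)
            fix Y assume "Y \<in> box (delete_nth j \<alpha>)"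
            then show "U H x Y = h x Y"
              using x length_of_box_delete_nth[OF j, of Y]
              by (simp add: U_def H_def nth_insert_nth delete_nth_insert_nth)
          qed (use hV[OF x] x in \<open>auto simp: PiE_def U_def\<close>)
        qed (use hPi in \<open>auto simp: PiE_def U_def\<close>)
        have HA: "H (insert_nth j x Y) \<in> A"
          if "x \<in> nlists (Suc k) B" "Y \<in> box (delete_nth j \<alpha>)" for x Y
          using hV[OF that(1)] that length_of_box_delete_nth[OF j, of Y]
          by (auto simp: H_def nth_insert_nth delete_nth_insert_nth PiE_iff)
        have "subst_at \<alpha> j (insert_nth i c) H \<in> \<rho>" if "i \<le> k" "c \<in> B" for i c
        proof -
          have "(\<lambda>xs\<in>nlists k B. h (insert_nth i c xs)) \<in> curry_at \<alpha> j ` \<rho>"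
            using heb that by (auto simp: ebtrl_def)
          then have "curry_at \<alpha> j (subst_at \<alpha> j (insert_nth i c) H) \<in> curry_at \<alpha> j ` \<rho>"
            using eq[of "insert_nth i c" H] ins[OF _ that(2)] by (simp add: UH)
          moreover have "subst_at \<alpha> j (insert_nth i c) H \<in> box \<alpha> \<rightarrow>\<^sub>E A"
            using HA ins[OF _ that(2)] by (intro subst_ext)
          ultimately show ?thesis
            using curry_at_mem_iff[OF j sub] by blast
        qed
        then have "subst_at \<alpha> j (\<lambda>x. insert_nth l (x ! i) x) H \<in> \<rho>"
          using R il by blast
        then show "h' \<in> curry_at \<alpha> j ` \<rho>"
          using eq_dup[OF il, where H = H] UH h' by simp
      qed
    qed
  qed
  then show ?thesis
    by (auto simp: transitive_def)
qed

section \<open>The Galois connection between operations and relations\<close>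

definition Inv :: "'a set \<Rightarrow> 'a op set \<Rightarrow> 'a frel set" where
  "Inv A F = {\<sigma> \<in> Rel A. \<forall>p\<in>F. preserves p \<sigma>}"

lemma Pol_Inv_Pol:
  assumes "Q \<subseteq> Rel A"
  shows "Pol A (Inv A (Pol A Q)) = Pol A Q"
  using assms by (auto simp: Pol_def Inv_def)

lemma map_nth_in_nlists:
  assumes "set ts \<subseteq> nlists k A" and "i < k"
  shows "map (\<lambda>r. r ! i) ts \<in> nlists (length ts) A"
  using assms by (auto simp: in_nlists_iff subset_iff)

text \<open>The operation acts on whole solutions, free and quantified variables together, and each
  atom is closed under it. Witnesses for the image tuple are the images of witnesses chosen for the
  given tuples.\<close>

lemma pp_rel_preserved:
  assumes f: "(n, f) \<in> Pol A Q" and wf: "\<forall>a\<in>set as. atom_wf Q (m + p) a"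
  shows "preserves (n, f) (pp_rel A m p as)"
  unfolding preserves_def pp_rel_def prod.case
proof (intro allI impI)
  let ?\<rho> = "{xs \<in> nlists m A. \<exists>ys\<in>nlists p A. \<forall>a\<in>set as. atom_holds (xs @ ys) a}"
  fix rs assume rs: "length rs = n \<and> set rs \<subseteq> ?\<rho>"
  have fA: "f ts \<in> A" if "ts \<in> nlists n A" for ts
    using f that by (auto simp: Pol_def Op_def)
  have "\<forall>r\<in>set rs. \<exists>ys. ys \<in> nlists p A \<and> (\<forall>a\<in>set as. atom_holds (r @ ys) a)"
    using rs by blast
  then obtain y where y: "\<And>r. r \<in> set rs \<Longrightarrow> y r \<in> nlists p A"
      "\<And>r a. r \<in> set rs \<Longrightarrow> a \<in> set as \<Longrightarrow> atom_holds (r @ y r) a"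
    by metis
  have r: "r \<in> nlists m A" if "r \<in> set rs" for r
    using rs that by auto
  define w where "w i = f (map (\<lambda>r. (r @ y r) ! i) rs)" for i
  have arg: "map (\<lambda>r. (r @ y r) ! i) rs \<in> nlists n A" if "i < m + p" for i
    using that rs r y(1) nth_mem[of i "r @ y r" for r]
    by (fastforce simp: in_nlists_iff nth_append subset_iff)
  have front: "map (\<lambda>r. r ! i) rs = map (\<lambda>r. (r @ y r) ! i) rs" if "i < m" for i
    using that r by (auto simp: in_nlists_iff nth_append)
  have w_eq: "map (\<lambda>i. f (map (\<lambda>r. r ! i) rs)) [0..<m] = map w [0..<m]"
    unfolding w_def by (intro map_cong refl arg_cong[of _ _ f] front) simp
  have "map w [0..<m] \<in> nlists m A" "map w [m..<m + p] \<in> nlists p A"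
    using fA[OF arg] by (auto simp: in_nlists_iff[of "map w _"] w_def)
  moreover have "atom_holds (map w [0..<m] @ map w [m..<m + p]) a" if a: "a \<in> set as" for a
  proof -
    have w: "map w [0..<m] @ map w [m..<m + p] = map w [0..<m + p]"
      by (metis map_append upt_add_eq_append zero_le)
    show ?thesis
    proof (cases a)
      case (EqAtom i j)
      then have "i < m + p" "j < m + p"
        using wf a by auto
      moreover have "w i = w j"
        using y(2)[OF _ a] EqAtom unfolding w_def by (auto intro!: arg_cong[of _ _ f])
      ultimately show ?thesis
        by (simp add: w EqAtom)
    next
      case (RelAtom \<sigma> js)
      obtain k \<tau> where \<sigma>: "\<sigma> = (k, \<tau>)" by force
      have js: "(k, \<tau>) \<in> Q" "length js = k" "\<And>j. j \<in> set js \<Longrightarrow> j < m + p"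
        using bspec[OF wf a] by (auto simp: RelAtom \<sigma> in_nlists_iff)
      let ?rs = "map (\<lambda>r. map (\<lambda>i. (r @ y r) ! i) js) rs"
      have "set ?rs \<subseteq> \<tau>" "length ?rs = n"
        using y(2)[OF _ a] rs by (auto simp: RelAtom \<sigma>)
      moreover have "preserves (n, f) (k, \<tau>)"
        using f js(1) by (auto simp: Pol_def)
      ultimately have "map (\<lambda>i. f (map (\<lambda>r. r ! i) ?rs)) [0..<k] \<in> \<tau>"
        unfolding preserves_def prod.case by blast
      also have "map (\<lambda>i. f (map (\<lambda>r. r ! i) ?rs)) [0..<k] = map (\<lambda>i. map w [0..<m + p] ! i) js"
      proof (rule nth_equalityI)
        fix l assume "l < length (map (\<lambda>i. f (map (\<lambda>r. r ! i) ?rs)) [0..<k])"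
        then have "l < length js" "js ! l < m + p"
          using js(2,3) by simp_all
        then show "map (\<lambda>i. f (map (\<lambda>r. r ! i) ?rs)) [0..<k] ! l
            = map (\<lambda>i. map w [0..<m + p] ! i) js ! l"
          using js(2) by (simp add: w_def o_def)
      qed (simp add: js(2))
      finally show ?thesis
        by (simp add: w RelAtom \<sigma>)
    qed
  qed
  ultimately show "map (\<lambda>i. f (map (\<lambda>r. r ! i) rs)) [0..<m] \<in> ?\<rho>"
    unfolding w_eq by blast
qed

lemma pp_rel_in_Rel: "m \<ge> 1 \<Longrightarrow> pp_rel A m p as \<in> Rel A"
  by (auto simp: Rel_def pp_rel_def)

section \<open>Primitive positive definability of invariant relations\<close>

lemma finite_subset_same_witnesses:
  assumes "finite Z"
  shows "\<exists>D\<subseteq>C. finite D \<and> (\<forall>z\<in>Z. (\<forall>a\<in>D. P z a) \<longrightarrow> (\<forall>a\<in>C. P z a))"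
proof -
  \<comment> \<open>For each \<open>z\<close> that violates a condition from \<open>C\<close>, one
    violated condition is kept; finiteness of \<open>Z\<close> makes these finitely many.\<close>
  have "\<forall>z. \<exists>a. \<not> (\<forall>a\<in>C. P z a) \<longrightarrow> a \<in> C \<and> \<not> P z a"
    by blast
  then obtain b where "\<And>z. \<not> (\<forall>a\<in>C. P z a) \<Longrightarrow> b z \<in> C \<and> \<not> P z (b z)"
    by metis
  then show ?thesis
    using assms by (intro exI[of _ "b ` {z \<in> Z. \<not> (\<forall>a\<in>C. P z a)}"]) auto
qed

text \<open>
  The existentially quantified variables of the defining formula are indexed by \<open>A\<^sup>n\<close> and hold the
  value table of an \<open>n\<close>-ary operation, where the \<open>n\<close> rows of \<open>rs\<close> enumerate \<open>\<rho>\<close>; the atoms say that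
  this operation preserves \<open>Q\<close> and maps \<open>rs\<close> to the tuple of free variables. As \<open>Q\<close> may be infinite,
  only finitely many atoms with the same solutions are kept.
\<close>

lemma invariant_in_rel_clone:
  assumes fin: "finite A" and Q: "Q \<subseteq> Rel A" and \<sigma>: "(m, \<rho>) \<in> Inv A (Pol A Q)" and ne: "\<rho> \<noteq> {}"
  shows "(m, \<rho>) \<in> rel_clone A Q"
proof -
  have m: "m \<ge> 1" and \<rho>: "\<rho> \<subseteq> nlists m A"
    using \<sigma> by (auto simp: Inv_def Rel_def)
  have fin_nlists: "finite (nlists k A)" for k
    using finite_lists_length_eq[OF fin, of k] by (simp add: nlists_def conj_commute)
  obtain rs where rs: "set rs = \<rho>"
    using finite_subset[OF \<rho> fin_nlists] finite_list by blast
  define n where "n = length rs"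
  \<comment> \<open>Operations have positive arity, which is why \<open>\<rho>\<close> has to be
    nonempty here.\<close>
  have n: "n \<ge> 1"
    using rs ne by (auto simp: n_def Suc_le_eq)
  obtain T where T: "set T = nlists n A"
    using finite_list[OF fin_nlists] by blast
  define N where "N = length T"
  have "\<forall>t\<in>nlists n A. \<exists>i. i < N \<and> T ! i = t"
    unfolding T[symmetric] by (simp add: in_set_conv_nth N_def)
  then obtain ix where ix: "\<And>t. t \<in> nlists n A \<Longrightarrow> ix t < N \<and> T ! ix t = t"
    by metis
  define F where "F zs = (\<lambda>t\<in>nlists n A. zs ! ix t)" for zs :: "'a list"
  \<comment> \<open>The free variables occupy the positions below \<open>m\<close>, hence the offset
    \<open>m\<close> for the value table. Column \<open>i\<close> of \<open>rs\<close> is the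
    argument whose value must be the \<open>i\<close>-th free variable.\<close>
  define eqs where "eqs = map (\<lambda>i. EqAtom i (m + ix (map (\<lambda>r. r ! i) rs)) :: 'a pp_atom) [0..<m]"
  define rat where "rat = (\<lambda>(k, \<tau>) ts.
    RelAtom (k, \<tau>) (map (\<lambda>i. m + ix (map (\<lambda>r. r ! i) ts)) [0..<k]) :: 'a pp_atom)"
  define C where "C = {rat (k, \<tau>) ts | k \<tau> ts. (k, \<tau>) \<in> Q \<and> length ts = n \<and> set ts \<subseteq> \<tau>}"
  have col: "map (\<lambda>r. r ! i) ts \<in> nlists n A"
    if "set ts \<subseteq> nlists k A" "length ts = n" "i < k" for ts k i
    using map_nth_in_nlists[of ts k A i] that by simp
  have F_ix: "F zs (map (\<lambda>r. r ! i) ts) = zs ! ix (map (\<lambda>r. r ! i) ts)"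
    if "set ts \<subseteq> nlists k A" "length ts = n" "i < k" for zs ts k i
    using col[OF that] by (simp add: F_def)
  have \<tau>: "\<tau> \<subseteq> nlists k A" if "(k, \<tau>) \<in> Q" for k \<tau>
    using that Q by (auto simp: Rel_def)
  have rat_holds: "atom_holds (x @ zs) (rat (k, \<tau>) ts) \<longleftrightarrow>
      map (\<lambda>i. F zs (map (\<lambda>r. r ! i) ts)) [0..<k] \<in> \<tau>"
    if "length x = m" "(k, \<tau>) \<in> Q" "length ts = n" "set ts \<subseteq> \<tau>" for x zs k \<tau> ts
  proof -
    have "map (\<lambda>i. (x @ zs) ! i) (map (\<lambda>i. m + ix (map (\<lambda>r. r ! i) ts)) [0..<k]) =
        map (\<lambda>i. F zs (map (\<lambda>r. r ! i) ts)) [0..<k]"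
      using that F_ix[OF subset_trans[OF that(4) \<tau>[OF that(2)]] that(3)] by (auto simp: nth_append)
    then show ?thesis
      by (simp only: rat_def prod.case atom_holds.simps snd_conv)
  qed
  have rs_col: "map (\<lambda>r. r ! i) rs \<in> nlists n A" if "i < m" for i
    using col[of rs m i] that rs \<rho> n_def by simp
  have eqs_hold: "(\<forall>a\<in>set eqs. atom_holds (x @ zs) a) \<longleftrightarrow>
      x = map (\<lambda>i. F zs (map (\<lambda>r. r ! i) rs)) [0..<m]"
    if "length x = m" for x zs
  proof -
    have "x = map (\<lambda>i. F zs (map (\<lambda>r. r ! i) rs)) [0..<m] \<longleftrightarrow>
        (\<forall>i<m. x ! i = F zs (map (\<lambda>r. r ! i) rs))"
      using that by (simp add: list_eq_iff_nth_eq)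
    then show ?thesis
      using that rs_col by (simp add: eqs_def nth_append F_def) (metis atLeast0LessThan lessThan_iff)
  qed
  have F_Pol: "(n, F zs) \<in> Pol A Q"
    if "zs \<in> nlists N A" "\<forall>a\<in>C. atom_holds (x @ zs) a" "length x = m" for x zs
  proof -
    have "F zs t \<in> A" if "t \<in> nlists n A" for t
      using ix[OF that] \<open>zs \<in> nlists N A\<close> that by (auto simp: F_def in_nlists_iff)
    then have "(n, F zs) \<in> Op A"
      using n unfolding Op_def by (auto simp: F_def)
    moreover have "map (\<lambda>i. F zs (map (\<lambda>r. r ! i) ts)) [0..<k] \<in> \<tau>"
      if "(k, \<tau>) \<in> Q" "length ts = n" "set ts \<subseteq> \<tau>" for k \<tau> ts
    proof -
      have "rat (k, \<tau>) ts \<in> C"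
        using that by (auto simp: C_def)
      then show ?thesis
        using that(2) rat_holds[OF \<open>length x = m\<close> that] \<open>\<forall>a\<in>C. _\<close> by blast
    qed
    ultimately show ?thesis
      by (auto simp: Pol_def preserves_def)
  qed
  obtain D where D: "D \<subseteq> C" "finite D"
    and D_C: "\<And>z. z \<in> nlists m A \<times> nlists N A \<Longrightarrow> \<forall>a\<in>D. atom_holds (fst z @ snd z) a \<Longrightarrow>
        \<forall>a\<in>C. atom_holds (fst z @ snd z) a"
    using finite_subset_same_witnesses[of "nlists m A \<times> nlists N A" C
        "\<lambda>z a. atom_holds (fst z @ snd z) a"] fin_nlists by (auto simp del: split_paired_All)
  obtain ds where ds: "set ds = D"
    using finite_list[OF D(2)] by blast
  have wf: "atom_wf Q (m + N) a" if "a \<in> set (eqs @ ds)" for a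
  proof (cases "a \<in> set eqs")
    case True
    then show ?thesis
      using ix[OF rs_col] by (auto simp: eqs_def trans_less_add1)
  next
    case False
    then have "a \<in> C"
      using that ds D by auto
    then show ?thesis
      using ix[OF col[OF _ _]] \<tau> by (fastforce simp: C_def rat_def in_nlists_iff)
  qed
  have "\<rho> = {xs \<in> nlists m A. \<exists>ys\<in>nlists N A. \<forall>a\<in>set (eqs @ ds). atom_holds (xs @ ys) a}"
  proof (intro set_eqI iffI)
    fix x assume x: "x \<in> \<rho>"
    then obtain l where l: "l < n" "x = rs ! l"
      using rs by (auto simp: in_set_conv_nth n_def)
    \<comment> \<open>The value table of the \<open>l\<close>-th projection, which satisfies all
      atoms of \<open>C\<close> and sends the columns of \<open>rs\<close> to
      \<open>rs ! l = x\<close>.\<close>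
    let ?zs = "map (\<lambda>t. t ! l) T"
    have proj: "F ?zs t = t ! l" if "t \<in> nlists n A" for t
      using ix[OF that] that by (simp add: F_def N_def)
    have len: "length x = m"
      using x \<rho> by (auto simp: in_nlists_iff)
    have "?zs \<in> nlists N A"
      unfolding in_nlists_iff[of "map _ T"] by (auto simp: T N_def nlistsE_nth_in l(1))
    moreover have "\<forall>a\<in>set eqs. atom_holds (x @ ?zs) a"
      unfolding eqs_hold[OF len] using l len rs_col
      by (intro nth_equalityI) (auto simp: proj n_def)
    moreover have "atom_holds (x @ ?zs) a" if a: "a \<in> C" for a
    proof -
      obtain k \<tau> ts where a: "a = rat (k, \<tau>) ts" and ts: "(k, \<tau>) \<in> Q" "length ts = n" "set ts \<subseteq> \<tau>"
        using a by (auto simp: C_def)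
      have "ts ! l \<in> \<tau>"
        using ts l by auto
      moreover have "length (ts ! l) = k"
        using \<tau>[OF ts(1)] \<open>ts ! l \<in> \<tau>\<close> by (auto simp: in_nlists_iff)
      then have "map (\<lambda>i. F ?zs (map (\<lambda>r. r ! i) ts)) [0..<k] = ts ! l"
        using ts \<tau>[OF ts(1)] col[of ts k] l by (intro nth_equalityI) (auto simp: proj)
      ultimately show ?thesis
        by (simp only: a rat_holds[OF len ts])
    qed
    ultimately show "x \<in> {xs \<in> nlists m A. \<exists>ys\<in>nlists N A. \<forall>a\<in>set (eqs @ ds). atom_holds (xs @ ys) a}"
      using D ds x \<rho> by (auto intro!: bexI[of _ ?zs])
  next
    fix x assume "x \<in> {xs \<in> nlists m A. \<exists>ys\<in>nlists N A. \<forall>a\<in>set (eqs @ ds). atom_holds (xs @ ys) a}"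
    then obtain zs where x: "x \<in> nlists m A" and zs: "zs \<in> nlists N A"
      and at: "\<forall>a\<in>set eqs. atom_holds (x @ zs) a" "\<forall>a\<in>D. atom_holds (x @ zs) a"
      by (auto simp: ds)
    have len: "length x = m"
      using x by (simp add: in_nlists_iff)
    have "(n, F zs) \<in> Pol A Q"
      using F_Pol[OF zs _ len] D_C[of "(x, zs)"] at x zs by simp
    \<comment> \<open>A solution is the value table of a polymorphism; applied to the rows
      \<open>rs\<close>, all in \<open>\<rho>\<close>, it yields \<open>x\<close>.\<close>
    then have "preserves (n, F zs) (m, \<rho>)"
      using \<sigma> by (auto simp: Inv_def)
    then show "x \<in> \<rho>"
      using at(1) rs unfolding eqs_hold[OF len] preserves_def n_def by simp
  qed
  then have "(m, \<rho>) = pp_rel A m N (eqs @ ds)"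
    by (simp add: pp_rel_def)
  then show ?thesis
    using wf m unfolding rel_clone_def by blast
qed

lemma rel_clone_eq_Inv_Pol:
  assumes "finite A" and "Q \<subseteq> Rel A"
  shows "rel_clone A Q = Inv A (Pol A Q)"
proof (rule set_eqI)
  fix \<sigma> :: "'a frel"
  obtain m \<rho> where \<sigma>: "\<sigma> = (m, \<rho>)" by force
  \<comment> \<open>The empty relation is invariant because every operation has at least one
    argument.\<close>
  have empty: "(m, {}) \<in> Inv A (Pol A Q) \<longleftrightarrow> m \<ge> 1"
    by (auto simp: Inv_def Rel_def Pol_def Op_def preserves_def)
  show "\<sigma> \<in> rel_clone A Q \<longleftrightarrow> \<sigma> \<in> Inv A (Pol A Q)"
  proof
    assume "\<sigma> \<in> rel_clone A Q"
    then show "\<sigma> \<in> Inv A (Pol A Q)"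
      unfolding rel_clone_def using empty \<sigma> pp_rel_preserved pp_rel_in_Rel
      by (fastforce simp: Inv_def[of A "Pol A Q"])
  next
    assume "\<sigma> \<in> Inv A (Pol A Q)"
    then show "\<sigma> \<in> rel_clone A Q"
      using invariant_in_rel_clone[OF assms, of m \<rho>] empty \<sigma>
      by (cases "\<rho> = {}") (auto simp: rel_clone_def)
  qed
qed

text \<open>Both relational clones have the form \<open>Inv\<close> of \<open>Pol\<close>, and
  applying \<open>Pol\<close> once more recovers the operations. This reduces the relational clones
  in (ii)' and (iii) to clones of polymorphisms.\<close>

lemma rel_clone_eq_iff:
  assumes "finite A" and "Q \<subseteq> Rel A" and "R \<subseteq> Rel A"
  shows "rel_clone A Q = rel_clone A R \<longleftrightarrow> Pol A Q = Pol A R"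
  using assms rel_clone_eq_Inv_Pol Pol_Inv_Pol by metis

section \<open>Clones and translations\<close>

lemma is_clone_Pol:
  assumes "Q \<subseteq> Rel A"
  shows "is_clone A (Pol A Q)"
  unfolding is_clone_def
proof (intro conjI allI impI)
  show "Pol A Q \<subseteq> Op A"
    by (auto simp: Pol_def)
next
  fix n i :: nat assume i: "i < n"
  have "preserves (proj_op A n i) (m, \<rho>)" if "(m, \<rho>) \<in> Q" for m \<rho>
    unfolding preserves_def proj_op_def prod.case
  proof (intro allI impI)
    fix rs assume rs: "length rs = n \<and> set rs \<subseteq> \<rho>"
    have \<rho>: "\<rho> \<subseteq> nlists m A"
      using assms that by (auto simp: Rel_def)
    have ri: "rs ! i \<in> \<rho>"
      using rs i by auto
    have "map (\<lambda>r. r ! l) rs \<in> nlists n A" if "l < m" for l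
      using map_nth_in_nlists[of rs m A l] rs \<rho> that by auto
    moreover have "length (rs ! i) = m"
      using ri \<rho> by (auto simp: in_nlists_iff)
    ultimately have "map (\<lambda>l. (\<lambda>xs\<in>nlists n A. xs ! i) (map (\<lambda>r. r ! l) rs)) [0..<m] = rs ! i"
      using i rs by (intro nth_equalityI) auto
    then show "map (\<lambda>l. (\<lambda>xs\<in>nlists n A. xs ! i) (map (\<lambda>r. r ! l) rs)) [0..<m] \<in> \<rho>"
      using ri by simp
  qed
  then show "proj_op A n i \<in> Pol A Q"
    using i by (auto simp: Pol_def Op_def proj_op_def nlistsE_nth_in)
next
  fix n f m gs
  assume H: "(n, f) \<in> Pol A Q \<and> length gs = n \<and> (\<forall>g\<in>set gs. (m, g) \<in> Pol A Q)"
  have fA: "f ts \<in> A" if "ts \<in> nlists n A" for ts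
    using H that by (auto simp: Pol_def Op_def)
  have gA: "g ts \<in> A" if "g \<in> set gs" "ts \<in> nlists m A" for g ts
    using H that by (auto simp: Pol_def Op_def)
  have "gs \<noteq> []"
    using H by (auto simp: Pol_def Op_def)
  then have m: "m \<ge> 1"
    using H by (cases gs) (auto simp: Pol_def Op_def)
  have arg: "map (\<lambda>g. g ts) gs \<in> nlists n A" if "ts \<in> nlists m A" for ts
    using H gA[OF _ that] by (auto simp: in_nlists_iff)
  have "preserves (comp_op A m f gs) (k, \<rho>)" if Q: "(k, \<rho>) \<in> Q" for k \<rho>
    unfolding preserves_def comp_op_def prod.case
  proof (intro allI impI)
    fix rs assume rs: "length rs = m \<and> set rs \<subseteq> \<rho>"
    have \<rho>: "\<rho> \<subseteq> nlists k A"
      using assms Q by (auto simp: Rel_def)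
    \<comment> \<open>Each \<open>g\<close> turns the rows \<open>rs\<close> into one row of
      \<open>\<rho>\<close>; \<open>f\<close> is then applied to these \<open>n\<close>
      rows.\<close>
    let ?ss = "map (\<lambda>g. map (\<lambda>l. g (map (\<lambda>r. r ! l) rs)) [0..<k]) gs"
    have "preserves (m, g) (k, \<rho>)" if "g \<in> set gs" for g
      using H Q that by (auto simp: Pol_def)
    then have "set ?ss \<subseteq> \<rho>"
      using rs by (auto simp: preserves_def)
    moreover have "preserves (n, f) (k, \<rho>)"
      using H Q by (auto simp: Pol_def)
    ultimately have "map (\<lambda>l. f (map (\<lambda>r. r ! l) ?ss)) [0..<k] \<in> \<rho>"
      using H unfolding preserves_def prod.case by (metis length_map)
    moreover have "map (\<lambda>r. r ! l) rs \<in> nlists m A" if "l < k" for l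
      using map_nth_in_nlists[of rs k A l] rs \<rho> that by auto
    then have "map (\<lambda>l. f (map (\<lambda>r. r ! l) ?ss)) [0..<k] =
        map (\<lambda>l. (\<lambda>xs\<in>nlists m A. f (map (\<lambda>g. g xs) gs)) (map (\<lambda>r. r ! l) rs)) [0..<k]"
      by (intro nth_equalityI) (auto simp: o_def)
    ultimately show "map (\<lambda>l. (\<lambda>xs\<in>nlists m A. f (map (\<lambda>g. g xs) gs)) (map (\<lambda>r. r ! l) rs)) [0..<k] \<in> \<rho>"
      by (simp only:)
  qed
  then show "comp_op A m f gs \<in> Pol A Q"
    using m arg fA by (auto simp: Pol_def Op_def comp_op_def)
qed

lemma clone_fragment_dary:
  assumes "is_clone A C"
  shows "clone_fragment A d (dary d C)"
proof -
  have "clone_gen A (dary d C) \<subseteq> C"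
    unfolding clone_gen_def using assms by (intro hull_minimal) (auto simp: dary_def)
  moreover have "dary d C \<subseteq> clone_gen A (dary d C)"
    unfolding clone_gen_def by (rule hull_subset)
  ultimately show ?thesis
    using assms unfolding clone_fragment_def is_clone_def dary_def by blast
qed

section \<open>Translations as compositions with projections and constants\<close>

lemma length_fill [simp]: "length (fill p xs) = length p"
  by (induction p xs rule: fill.induct) auto

text \<open>The variables are consumed in order, so the one at a kept position \<open>i\<close> has
  as its index the number of kept positions before \<open>i\<close>.\<close>

lemma fill_eq_map:
  assumes "count_list p None \<le> length xs"
  shows "fill p xs = map (\<lambda>i. case p ! i of Some c \<Rightarrow> c | None \<Rightarrow> xs ! count_list (take i p) None)
    [0..<length p]"
  using assms
proof (induction p xs rule: fill.induct)
  case (2 c p xs)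
  then show ?case
    by (simp add: upt_conv_Cons map_Suc_upt[symmetric] del: upt_Suc cong: option.case_cong)
next
  case (3 p xs)
  then obtain x xs' where "xs = x # xs'"
    by (cases xs) auto
  then show ?case
    using 3 by (simp add: upt_conv_Cons map_Suc_upt[symmetric] del: upt_Suc cong: option.case_cong)
qed simp

lemma fill_in_nlists:
  assumes "length p = n" and "\<And>c. Some c \<in> set p \<Longrightarrow> c \<in> A"
    and "count_list p None \<le> length xs" and "set xs \<subseteq> A"
  shows "fill p xs \<in> nlists n A"
proof -
  have "set (fill p xs) \<subseteq> {c. Some c \<in> set p} \<union> set xs"
    using assms(3)
  proof (induction p xs rule: fill.induct)
    case (3 p xs)
    then show ?case by (cases xs) auto
  qed auto
  then show ?thesis
    using assms by (auto simp: in_nlists_iff)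
qed

lemma count_list_take_less:
  assumes "i < length p" and "p ! i = x"
  shows "count_list (take i p) x < count_list p x"
proof -
  have "count_list p x = count_list (take i p) x + count_list (drop i p) x"
    by (metis append_take_drop_id count_list_append)
  moreover have "count_list (drop i p) x > 0"
    using assms by (simp add: Cons_nth_drop_Suc[symmetric])
  ultimately show ?thesis
    by simp
qed

text \<open>Makes closure properties of clones applicable to translations, which are defined by
  patterns.\<close>

lemma trl_comp_op:
  assumes q: "q \<in> trl A d (n, f)"
  obtains gs where "length gs = n" "q = comp_op A d f gs"
    "\<And>g. g \<in> set gs \<Longrightarrow> (\<exists>i<d. (d, g) = proj_op A d i) \<or> (\<exists>c\<in>A. (d, g) = const_op A d c)"
proof -
  obtain p u t v where p: "length p = n" "\<And>c. Some c \<in> set p \<Longrightarrow> c \<in> A" "t = count_list p None"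
      "u + t + v = d" and q: "q = (d, \<lambda>xs\<in>nlists d A. f (fill p (take t (drop u xs))))"
    using q unfolding trl_def by auto
  \<comment> \<open>The first \<open>u\<close> variables are fictitious, hence the shift by
    \<open>u\<close> in the index of the projection.\<close>
  define G where "G i = (case p ! i of Some c \<Rightarrow> snd (const_op A d c)
    | None \<Rightarrow> snd (proj_op A d (u + count_list (take i p) None)))" for i
  have G: "(case p ! i of Some c \<Rightarrow> c | None \<Rightarrow> take t (drop u xs) ! count_list (take i p) None) = G i xs"
    if "xs \<in> nlists d A" "i < n" for xs i
    using that p count_list_take_less[of i p None]
    by (auto simp: G_def const_op_def proj_op_def in_nlists_iff split: option.splits)
  show ?thesis
  proof
    have "fill p (take t (drop u xs)) = map (\<lambda>g. g xs) (map G [0..<n])" if "xs \<in> nlists d A" for xs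
    proof -
      have "count_list p None \<le> length (take t (drop u xs))"
        using that p by (simp add: in_nlists_iff)
      then show ?thesis
        using G[OF that] p(1) by (simp add: fill_eq_map)
    qed
    then show "q = comp_op A d f (map G [0..<n])"
      unfolding q comp_op_def by (auto intro!: restrict_ext)
    fix g assume "g \<in> set (map G [0..<n])"
    then obtain i where i: "i < n" "g = G i" by auto
    show "(\<exists>i<d. (d, g) = proj_op A d i) \<or> (\<exists>c\<in>A. (d, g) = const_op A d c)"
    proof (cases "p ! i")
      case None
      then have "u + count_list (take i p) None < d"
        using count_list_take_less[of i p None] i p by auto
      then show ?thesis
        using None i by (auto simp: G_def proj_op_def)
    next
      case (Some c)
      then have "c \<in> A"
        using p(1,2) i nth_mem by metis
      then show ?thesis
        using Some i by (auto simp: G_def const_op_def)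
    qed
  qed simp
qed

lemma trl_subset_clone:
  assumes "is_clone A C" and "\<And>c. c \<in> A \<Longrightarrow> const_op A d c \<in> C" and "(n, f) \<in> C"
  shows "trl A d (n, f) \<subseteq> dary d C"
proof
  fix q assume "q \<in> trl A d (n, f)"
  then obtain gs where gs: "length gs = n" "q = comp_op A d f gs"
    "\<And>g. g \<in> set gs \<Longrightarrow> (\<exists>i<d. (d, g) = proj_op A d i) \<or> (\<exists>c\<in>A. (d, g) = const_op A d c)"
    using trl_comp_op by blast
  have "(d, g) \<in> C" if "g \<in> set gs" for g
    using gs(3)[OF that] assms(1,2) unfolding is_clone_def by metis
  then have "comp_op A d f gs \<in> C"
    using assms(1,3) gs(1) unfolding is_clone_def by blast
  then show "q \<in> dary d C"
    unfolding gs(2) by (simp add: dary_def comp_op_def)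
qed

lemma clone_subset_star_op:
  assumes "is_clone A C" and "\<And>c. c \<in> A \<Longrightarrow> const_op A d c \<in> C"
  shows "C \<subseteq> star_op A d (dary d C)"
  using assms trl_subset_clone[OF assms] by (auto simp: star_op_def is_clone_def)

lemma trl_const_op:
  assumes "c \<in> A"
  shows "const_op A d c \<in> trl A d (proj_op A 1 0)"
proof -
  have "const_op A d c =
      (d, \<lambda>xs\<in>nlists d A. (\<lambda>xs\<in>nlists 1 A. xs ! 0) (fill [Some c] (take 0 (drop 0 xs))))"
    using assms by (auto simp: const_op_def in_nlists_iff intro!: restrict_ext)
  then show ?thesis
    using assms unfolding trl_def proj_op_def prod.case
    by (intro CollectI exI[of _ "[Some c]"] exI[of _ 0] exI[of _ d]) auto
qed

lemma Xi_imp_constants: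
  assumes "Q \<subseteq> Rel A" and "Xi A d Q" and "c \<in> A"
  shows "const_op A d c \<in> Pol A Q"
proof -
  have "proj_op A 1 0 \<in> star_op A d (dary d (Pol A Q))"
    using is_clone_Pol[OF assms(1)] assms(2) unfolding Xi_def is_clone_def by (metis zero_less_one)
  then show ?thesis
    using trl_const_op[OF assms(3)] by (auto simp: star_op_def dary_def)
qed

section \<open>R-relations as ordinary relations\<close>

text \<open>Listing the values along \<open>en\<close> is injective on extensional functions and
  commutes with pointwise application of \<open>f\<close>, so the two preservation conditions
  correspond.\<close>

lemma preserves_ring_rel_iff:
  fixes \<alpha> :: "'b arity" and \<rho> :: "('b list list \<Rightarrow> 'a) set"
  assumes bij: "bij_betw (en \<alpha>) {..<card (box \<alpha>)} (box \<alpha>)" and \<rho>: "\<rho> \<subseteq> box \<alpha> \<rightarrow>\<^sub>E A"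
  shows "preserves (n, f) (ring_rel en (\<alpha>, \<rho>)) \<longleftrightarrow> preserves_rrel (n, f) (\<alpha>, \<rho>)"
proof -
  define enc where "enc g = map (\<lambda>i. g (en \<alpha> i)) [0..<card (box \<alpha>)]" for g :: "'b list list \<Rightarrow> 'a"
  have ring: "ring_rel en (\<alpha>, \<rho>) = (card (box \<alpha>), enc ` \<rho>)"
    by (auto simp: ring_rel_def enc_def)
  have inj: "inj_on enc (extensional (box \<alpha>))"
  proof (rule inj_onI)
    fix g h assume ext: "g \<in> extensional (box \<alpha>)" "h \<in> extensional (box \<alpha>)" and eq: "enc g = enc h"
    have "g (en \<alpha> i) = h (en \<alpha> i)" if "i < card (box \<alpha>)" for i
      using eq that by (simp add: enc_def)
    then have "g X = h X" if "X \<in> box \<alpha>" for X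
      using bij_betw_imp_surj_on[OF bij] that by (metis imageE lessThan_iff)
    then show "g = h"
      using ext by (intro extensionalityI)
  qed
  have enc: "map (\<lambda>i. f (map (\<lambda>r. r ! i) (map enc gs))) [0..<card (box \<alpha>)] =
      enc (\<lambda>X\<in>box \<alpha>. f (map (\<lambda>g. g X) gs))" for gs
    using bij_betwE[OF bij] by (auto simp: enc_def o_def)
  have mem: "enc (\<lambda>X\<in>box \<alpha>. f (map (\<lambda>g. g X) gs)) \<in> enc ` \<rho> \<longleftrightarrow>
      (\<lambda>X\<in>box \<alpha>. f (map (\<lambda>g. g X) gs)) \<in> \<rho>" for gs
    using \<rho> by (intro inj_on_image_mem_iff[OF inj]) (auto dest: PiE_iff[THEN iffD1])
  have lists: "(\<forall>rs. length rs = n \<and> set rs \<subseteq> enc ` \<rho> \<longrightarrow> P rs) \<longleftrightarrow>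
      (\<forall>gs. length gs = n \<and> set gs \<subseteq> \<rho> \<longrightarrow> P (map enc gs))" for P
    using lists_image[of enc \<rho>] unfolding lists_eq_set
    by (auto simp: set_eq_iff image_iff) (metis length_map)
  show ?thesis
    unfolding ring preserves_def preserves_rrel_def prod.case lists enc mem ..
qed

lemma GQuord_subset: "(\<alpha>, \<rho>) \<in> GQuord d A \<Longrightarrow> \<rho> \<subseteq> box \<alpha> \<rightarrow>\<^sub>E A"
  by (auto simp: GQuord_def gen_quasiorder_def)

lemma canonical_box_not_empty:
  assumes "canonical_arity \<alpha>"
  shows "box \<alpha> \<noteq> {}"
proof -
  have "replicate (snd (\<alpha> ! j)) 0 \<in> nlists (snd (\<alpha> ! j)) (fst (\<alpha> ! j))" if "j < length \<alpha>" for j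
    using assms nth_mem[OF that] by (fastforce simp: canonical_arity_def in_nlists_iff)
  then have "map (\<lambda>(B, d). replicate d 0) \<alpha> \<in> box \<alpha>"
    by (simp add: in_box_iff case_prod_beta)
  then show ?thesis
    by blast
qed

lemma ring_rel_in_Rel:
  assumes "canonical_arity \<alpha>" and "bij_betw (en \<alpha>) {..<card (box \<alpha>)} (box \<alpha>)"
    and "\<rho> \<subseteq> box \<alpha> \<rightarrow>\<^sub>E A"
  shows "ring_rel en (\<alpha>, \<rho>) \<in> Rel A"
proof -
  have "finite (box \<alpha>)"
    using assms(2) bij_betw_finite by blast
  then have "card (box \<alpha>) \<ge> 1"
    using canonical_box_not_empty[OF assms(1)] by (simp add: Suc_le_eq card_gt_0_iff)
  moreover have "map (\<lambda>i. g (en \<alpha> i)) [0..<card (box \<alpha>)] \<in> nlists (card (box \<alpha>)) A" if "g \<in> \<rho>" for g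
  proof -
    have "g \<in> box \<alpha> \<rightarrow>\<^sub>E A"
      using assms(3) that by blast
    then show ?thesis
      using bij_betwE[OF assms(2)] by (auto simp: in_nlists_iff PiE_mem)
  qed
  ultimately show ?thesis
    by (auto simp: ring_rel_def Rel_def)
qed

lemma ring_rel_GQuord_subset_Rel:
  assumes "Q' \<subseteq> GQuord d A"
    and "\<And>\<alpha>. canonical_arity \<alpha> \<Longrightarrow> bij_betw (en \<alpha>) {..<card (box \<alpha>)} (box \<alpha>)"
  shows "ring_rel en ` Q' \<subseteq> Rel A"
proof (intro image_subsetI)
  fix \<sigma> assume \<sigma>: "\<sigma> \<in> Q'"
  obtain \<alpha> \<rho> where eq: "\<sigma> = (\<alpha>, \<rho>)" by force
  have "(\<alpha>, \<rho>) \<in> GQuord d A"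
    using \<sigma> assms(1) eq by blast
  then show "ring_rel en \<sigma> \<in> Rel A"
    unfolding eq using assms(2) GQuord_subset[of \<alpha> \<rho>]
    by (intro ring_rel_in_Rel) (simp_all add: GQuord_def)
qed

lemma Pol_ring_rel:
  assumes "Q' \<subseteq> GQuord d A"
    and "\<And>\<alpha>. canonical_arity \<alpha> \<Longrightarrow> bij_betw (en \<alpha>) {..<card (box \<alpha>)} (box \<alpha>)"
  shows "Pol A (ring_rel en ` Q') = Pol_rrel A Q'"
proof -
  have "preserves p (ring_rel en \<sigma>) \<longleftrightarrow> preserves_rrel p \<sigma>" if \<sigma>: "\<sigma> \<in> Q'" for p \<sigma>
  proof -
    obtain \<alpha> \<rho> where eq: "\<sigma> = (\<alpha>, \<rho>)" by force
    have "(\<alpha>, \<rho>) \<in> GQuord d A"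
      using \<sigma> assms(1) eq by blast
    then have "canonical_arity \<alpha>" "\<rho> \<subseteq> box \<alpha> \<rightarrow>\<^sub>E A"
      using GQuord_subset[of \<alpha> \<rho>] by (auto simp: GQuord_def)
    then show ?thesis
      unfolding eq using preserves_ring_rel_iff[of en \<alpha> \<rho> A "fst p" "snd p"] assms(2) by simp
  qed
  then show ?thesis
    by (simp add: Pol_def Pol_rrel_def)
qed


section \<open>A clone fragment as a generalized quasiorder\<close>

lemma map_insert_nth: "map h (insert_nth i c xs) = insert_nth i (h c) (map h xs)"
  by (simp add: insert_nth_def take_map drop_map)

lemma trlI:
  assumes "\<And>xs. xs \<in> nlists d A \<Longrightarrow> g xs = f (fill p (take t (drop u xs)))"
    and "length p = n" and "\<And>c. Some c \<in> set p \<Longrightarrow> c \<in> A" and "count_list p None = t" and "u + t \<le> d"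
  shows "(d, \<lambda>xs\<in>nlists d A. g xs) \<in> trl A d (n, f)"
proof -
  have "(d, \<lambda>xs\<in>nlists d A. g xs) = (d, \<lambda>xs\<in>nlists d A. f (fill p (take t (drop u xs))))"
    using assms(1) by (auto intro!: restrict_ext)
  then show ?thesis
    unfolding trl_def prod.case using assms(2-5)
    by (intro CollectI exI[of _ p] exI[of _ t] exI[of _ u] exI[of _ "d - (u + t)"]) auto
qed

lemma fill_insert_nth_Some:
  "i \<le> length p \<Longrightarrow> fill (insert_nth i (Some c) p) xs = insert_nth i c (fill p xs)"
proof (induction p xs arbitrary: i rule: fill.induct)
  case (1 xs)
  then show ?case by (simp add: insert_nth_def)
next
  case (2 a p xs)
  then show ?case by (cases i) (auto simp: insert_nth_def)
next
  case (3 p xs)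
  then show ?case by (cases i) (auto simp: insert_nth_def)
qed

lemma count_list_insert_nth:
  "count_list (insert_nth i a p) x = (if a = x then 1 else 0) + count_list p x"
proof -
  have "count_list p x = count_list (take i p) x + count_list (drop i p) x"
    by (metis append_take_drop_id count_list_append)
  then show ?thesis
    by (simp add: insert_nth_def)
qed

lemma count_list_replicate_same: "count_list (replicate n x) x = n"
  by (induction n) auto

lemma fill_replicate_None: "length xs = n \<Longrightarrow> fill (replicate n None) xs = xs"
  by (induction n arbitrary: xs) (auto simp: length_Suc_conv)

lemma count_list_less_length:
  "count_list p x < length p \<Longrightarrow> \<exists>i<length p. p ! i \<noteq> x"
  using filter_True[of p "(=) x"] unfolding count_list_eq_length_filter
  by (metis in_set_conv_nth less_irrefl)

text \<open>At most \<open>d\<close> variables are kept, so a pattern of length \<open>Suc d\<close>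
  has a constant \<open>c\<close> at some position \<open>i\<close>. Deleting that position leaves a
  pattern for the section of \<open>H\<close> by \<open>c\<close> at \<open>i\<close>.\<close>

lemma trl_Suc_subset:
  assumes "\<And>i c. i \<le> d \<Longrightarrow> c \<in> A \<Longrightarrow>
    trl A d (d, \<lambda>xs\<in>nlists d A. H (insert_nth i c xs)) \<subseteq> M"
  shows "trl A d (Suc d, H) \<subseteq> M"
proof
  fix q assume "q \<in> trl A d (Suc d, H)"
  then obtain p u t v where p: "length p = Suc d" "\<And>c. Some c \<in> set p \<Longrightarrow> c \<in> A"
      "t = count_list p None" "u + t + v = d"
    and q: "q = (d, \<lambda>xs\<in>nlists d A. H (fill p (take t (drop u xs))))"
    unfolding trl_def by auto
  obtain i where i: "i < length p" "p ! i \<noteq> None"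
    using count_list_less_length[of p None] p by auto
  then obtain c where c: "p ! i = Some c"
    by blast
  let ?p = "delete_nth i p"
  have ins: "p = insert_nth i (Some c) ?p"
    using insert_nth_delete_nth[OF i(1)] c by simp
  have len: "length ?p = d" "i \<le> d"
    using i p(1) by (auto simp: length_delete_nth)
  have A: "c \<in> A" "\<And>a. Some a \<in> set ?p \<Longrightarrow> a \<in> A"
    using p(2) ins by (metis insertI1 set_insert_nth) (metis insertI2 ins p(2) set_insert_nth)
  have t: "t = count_list ?p None"
    using p(3) ins count_list_insert_nth[of i "Some c" ?p None] by simp
  have "fill ?p (take t (drop u xs)) \<in> nlists d A" if "xs \<in> nlists d A" for xs
  proof (rule fill_in_nlists)
    show "count_list ?p None \<le> length (take t (drop u xs))" "set (take t (drop u xs)) \<subseteq> A"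
      using that t p(4) set_take_subset[of t "drop u xs"] set_drop_subset[of u xs]
      by (auto simp: in_nlists_iff)
  qed (use len A in auto)
  then have "q \<in> trl A d (d, \<lambda>xs\<in>nlists d A. H (insert_nth i c xs))"
    unfolding q using len A(2) t p(4)
    by (intro trlI) (auto simp: fill_insert_nth_Some[symmetric] ins[symmetric])
  then show "q \<in> M"
    using assms[OF len(2) A(1)] by blast
qed

text \<open>For \<open>i > 0\<close> the entry removed by \<open>tl\<close> is the first variable,
  which becomes fictitious (\<open>u = 1\<close>), and \<open>a\<close> moves to position
  \<open>i - 1\<close>. For \<open>i = 0\<close> the constant itself would be removed.\<close>

lemma trl_tl_insert_nth:
  assumes "i \<le> d" and "i > 0" and "a \<in> A"
  shows "(d, \<lambda>xs\<in>nlists d A. f (tl (insert_nth i a xs))) \<in> trl A d (d, f)"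
proof -
  let ?p = "insert_nth (i - 1) (Some a) (replicate (d - 1) None)"
  have "fill ?p (take (d - 1) (drop 1 xs)) = tl (insert_nth i a xs)" if "xs \<in> nlists d A" for xs
  proof -
    have "length xs = Suc (d - 1)"
      using that assms by (simp add: in_nlists_iff)
    then obtain x ys where "xs = x # ys" "length ys = d - 1"
      by (auto simp: length_Suc_conv)
    then show ?thesis
      using assms fill_insert_nth_Some[of "i - 1" "replicate (d - 1) None" a ys]
      by (cases i) (auto simp: fill_replicate_None insert_nth_def)
  qed
  then show ?thesis
    using assms
    by (intro trlI[where p = ?p and t = "d - 1" and u = 1])
      (auto simp: count_list_insert_nth count_list_replicate_same)
qed

text \<open>Here the last variable becomes fictitious (\<open>u = 0\<close>); for
  \<open>i = d\<close> the constant itself would be removed.\<close>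

lemma trl_butlast_insert_nth:
  assumes "i < d" and "a \<in> A"
  shows "(d, \<lambda>xs\<in>nlists d A. f (butlast (insert_nth i a xs))) \<in> trl A d (d, f)"
proof -
  let ?p = "insert_nth i (Some a) (replicate (d - 1) None)"
  have "fill ?p (take (d - 1) (drop 0 xs)) = butlast (insert_nth i a xs)" if "xs \<in> nlists d A" for xs
  proof -
    have len: "length xs = d"
      using that by (simp add: in_nlists_iff)
    then obtain ys x where xs: "xs = ys @ [x]"
      using assms(1) by (cases xs rule: rev_cases) auto
    then have "butlast (insert_nth i a xs) = insert_nth i a ys"
      using len assms(1) by (simp add: insert_nth_def butlast_append)
    then show ?thesis
      using xs len assms by (simp add: fill_insert_nth_Some fill_replicate_None)
  qed
  then show ?thesis
    using assms
    by (intro trlI[where p = ?p and t = "d - 1" and u = 0])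
      (auto simp: count_list_insert_nth count_list_replicate_same)
qed

section \<open>Operations on A as functions on a power of an ordinal\<close>

lemma in_box_single_iff: "X \<in> box [(B, d)] \<longleftrightarrow> (\<exists>x\<in>nlists d B. X = [x])"
  by (auto simp: in_box_iff length_Suc_conv)

context
  fixes A :: "'a set" and e :: "nat \<Rightarrow> 'a" and d :: nat
  assumes e: "bij_betw e {..<card A} A" and d: "d \<ge> 1"
begin

abbreviation (input) ar :: "nat arity" where
  "ar \<equiv> [({..<card A}, d)]"

definition rfun :: "('a list \<Rightarrow> 'a) \<Rightarrow> nat list list \<Rightarrow> 'a" where
  "rfun f = (\<lambda>X\<in>box ar. f (map e (hd X)))"

lemma ops_rrel_eq: "ops_rrel e A d M = (ar, {rfun f | f. (d, f) \<in> M})"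
  by (simp add: ops_rrel_def rfun_def Let_def)

lemma rfun_single: "x \<in> nlists d {..<card A} \<Longrightarrow> rfun f [x] = f (map e x)"
  by (simp add: rfun_def in_box_single_iff)

lemma map_e_in_nlists: "x \<in> nlists n {..<card A} \<Longrightarrow> map e x \<in> nlists n A"
  using bij_betwE[OF e] by (auto simp: in_nlists_iff)

lemma nlists_eq_map_e:
  assumes "xs \<in> nlists n A"
  obtains x where "x \<in> nlists n {..<card A}" "xs = map e x"
proof
  let ?x = "map (inv_into {..<card A} e) xs"
  show "?x \<in> nlists n {..<card A}"
    using assms bij_betw_imp_surj_on[OF e] inv_into_into[of _ e "{..<card A}"]
    by (auto simp: in_nlists_iff subset_iff)
  show "xs = map e ?x"
    using assms bij_betw_inv_into_right[OF e]
    by (auto simp: in_nlists_iff subset_iff intro!: map_idI[symmetric])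
qed

lemma rfun_restrict: "rfun (\<lambda>xs\<in>nlists d A. f xs) = rfun f"
  unfolding rfun_def by (intro restrict_ext) (auto simp: in_box_single_iff map_e_in_nlists)

lemma inj_on_rfun: "inj_on rfun (extensional (nlists d A))"
proof (rule inj_onI)
  fix f g assume "f \<in> extensional (nlists d A)" "g \<in> extensional (nlists d A)"
    and eq: "rfun f = rfun g"
  moreover have "f xs = g xs" if "xs \<in> nlists d A" for xs
    using nlists_eq_map_e[OF that] rfun_single eq by metis
  ultimately show "f = g"
    by (intro extensionalityI)
qed

lemma rfun_mem_iff:
  assumes "M \<subseteq> Op A" and "f \<in> extensional (nlists d A)"
  shows "rfun f \<in> {rfun f | f. (d, f) \<in> M} \<longleftrightarrow> (d, f) \<in> M"
proof -
  have "{f. (d, f) \<in> M} \<subseteq> extensional (nlists d A)"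
    using assms(1) by (auto simp: Op_def PiE_def)
  then have "rfun f \<in> rfun ` {f. (d, f) \<in> M} \<longleftrightarrow> f \<in> {f. (d, f) \<in> M}"
    by (intro inj_on_image_mem_iff[OF inj_on_rfun assms(2)])
  then show ?thesis
    by (simp add: image_Collect)
qed

lemma rfun_PiE:
  assumes "(d, f) \<in> Op A"
  shows "rfun f \<in> box ar \<rightarrow>\<^sub>E A"
  using assms map_e_in_nlists unfolding rfun_def
  by (intro PiE_I) (auto simp: in_box_single_iff Op_def)

lemma subst_at_rfun:
  assumes "\<And>x. x \<in> nlists d {..<card A} \<Longrightarrow> \<phi> x \<in> nlists d {..<card A}"
    and "\<And>x. x \<in> nlists d {..<card A} \<Longrightarrow> map e (\<phi> x) = \<psi> (map e x)"
  shows "subst_at ar 0 \<phi> (rfun f) = rfun (\<lambda>xs\<in>nlists d A. f (\<psi> xs))"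
  unfolding subst_at_def rfun_restrict
  unfolding rfun_def[of "\<lambda>xs. f (\<psi> xs)"]
  using assms by (intro restrict_ext) (auto simp: in_box_single_iff rfun_single)

text \<open>Internal reflexivity holds because the clone contains the constants and with them all
  translations of its members. For transitivity, \<open>star\<close> brings the operation of arity
  \<open>Suc d\<close> into the clone, where identifying variables is composition with
  projections.\<close>

lemma ops_rrel_in_GQuord:
  assumes fin: "finite A" and ne: "A \<noteq> {}"
    and C: "is_clone A C" and const: "\<And>c. c \<in> A \<Longrightarrow> const_op A d c \<in> C"
    and star: "star_op A d (dary d C) \<subseteq> C"
  shows "ops_rrel e A d (dary d C) \<in> GQuord d A"
proof -
  define \<rho> where "\<rho> = {rfun f | f. (d, f) \<in> dary d C}"
  have CO: "C \<subseteq> Op A" and dC: "dary d C \<subseteq> Op A"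
    using C by (auto simp: is_clone_def dary_def)
  have sub: "\<rho> \<subseteq> box ar \<rightarrow>\<^sub>E A"
    using rfun_PiE dC by (auto simp: \<rho>_def simp del: PiE_iff)
  have "canonical_arity ar" "dimension ar = d"
    using fin ne d by (auto simp: canonical_arity_def dimension_def Suc_le_eq card_gt_0_iff)
  moreover have "(\<lambda>X\<in>box ar. c) \<in> \<rho>" if "c \<in> A" for c
  proof -
    have "(\<lambda>X\<in>box ar. c) = rfun (\<lambda>xs\<in>nlists d A. c)"
      unfolding rfun_restrict by (simp add: rfun_def)
    then show ?thesis
      using const[OF that] by (auto simp: \<rho>_def dary_def const_op_def)
  qed
  moreover have "int_reflexive A (ar, \<rho>)"
    unfolding int_reflexive_iff[OF sub]
  proof (intro allI impI ballI)
    fix j g i c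
    assume "j < length ar" "g \<in> \<rho>" "i \<le> snd (ar ! j)" "c \<in> fst (ar ! j)"
    then obtain f where f: "(d, f) \<in> C" "g = rfun f" and j: "j = 0" and i: "i \<le> d" and c: "c < card A"
      by (auto simp: \<rho>_def dary_def)
    have ec: "e c \<in> A"
      using bij_betwE[OF e] c by auto
    have ins: "insert_nth i c x \<in> nlists (Suc d) {..<card A}" if "x \<in> nlists d {..<card A}" for x
      using insert_nth_in_nlists[OF that] c by simp
    have trl: "trl A d (d, f) \<subseteq> dary d C"
      using trl_subset_clone[OF C const f(1)] .
    have tl: "(d, \<lambda>xs\<in>nlists d A. f (tl (insert_nth i (e c) xs))) \<in> dary d C"
    proof (cases "i = 0")
      case True
      have "(\<lambda>xs\<in>nlists d A. f (tl (insert_nth i (e c) xs))) = f"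
        using f(1) CO True by (intro extensionalityI[of _ "nlists d A"])
          (auto simp: Op_def PiE_def insert_nth_def)
      then show ?thesis
        using f(1) by (simp add: dary_def)
    next
      case False
      then show ?thesis
        using trl_tl_insert_nth[OF i _ ec] trl by auto
    qed
    have butlast: "(d, \<lambda>xs\<in>nlists d A. f (butlast (insert_nth i (e c) xs))) \<in> dary d C"
    proof (cases "i = d")
      case True
      have "(\<lambda>xs\<in>nlists d A. f (butlast (insert_nth i (e c) xs))) = f"
        using f(1) CO True by (intro extensionalityI[of _ "nlists d A"])
          (auto simp: Op_def PiE_def insert_nth_def in_nlists_iff)
      then show ?thesis
        using f(1) by (simp add: dary_def)
    next
      case False
      then show ?thesis
        using trl_butlast_insert_nth[OF _ ec] i trl by auto
    qed
    have "subst_at ar 0 (\<lambda>x. tl (insert_nth i c x)) (rfun f) =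
        rfun (\<lambda>xs\<in>nlists d A. f (tl (insert_nth i (e c) xs)))"
      using tl_in_nlists[OF ins] by (intro subst_at_rfun) (auto simp: map_tl map_insert_nth)
    moreover have "subst_at ar 0 (\<lambda>x. butlast (insert_nth i c x)) (rfun f) =
        rfun (\<lambda>xs\<in>nlists d A. f (butlast (insert_nth i (e c) xs)))"
      using butlast_in_nlists[OF ins] by (intro subst_at_rfun) (auto simp: map_butlast map_insert_nth)
    ultimately show "subst_at ar j (\<lambda>x. tl (insert_nth i c x)) g \<in> \<rho> \<and>
        subst_at ar j (\<lambda>x. butlast (insert_nth i c x)) g \<in> \<rho>"
      using tl butlast unfolding f(2) j \<rho>_def by blast
  qed
  moreover have "transitive A (ar, \<rho>)"
    unfolding transitive_iff[OF sub]
  proof (intro allI impI)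
    fix j H l i
    assume j: "j < length ar"
      and H: "\<forall>i\<le>snd (ar ! j). \<forall>c\<in>fst (ar ! j). subst_at ar j (insert_nth i c) H \<in> \<rho>"
      and l: "l \<le> snd (ar ! j)" and i: "i < l"
    have j: "j = 0" and l: "l \<le> d" using j l by auto
    \<comment> \<open>\<open>H\<close> takes lists of ordinals; \<open>H'\<close> is the operation
      of arity \<open>Suc d\<close> on \<open>A\<close> that corresponds to it under
      \<open>e\<close>.\<close>
    define H' where "H' = (\<lambda>xs\<in>nlists (Suc d) A. H [map (inv_into {..<card A} e) xs])"
    have H'_map: "H' (map e x) = H [x]" if "x \<in> nlists (Suc d) {..<card A}" for x
    proof -
      have "map (inv_into {..<card A} e) (map e x) = x"
        using that bij_betw_inv_into_left[OF e]
        by (auto simp: in_nlists_iff subset_iff intro!: map_idI)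
      then show ?thesis
        using map_e_in_nlists[OF that] by (simp add: H'_def)
    qed
    have sect: "(d, \<lambda>xs\<in>nlists d A. H' (insert_nth i a xs)) \<in> dary d C" if "i \<le> d" "a \<in> A" for i a
    proof -
      from that(2) obtain c where c: "c < card A" "a = e c"
        using bij_betw_imp_surj_on[OF e] by auto
      then have "subst_at ar 0 (insert_nth i c) H \<in> \<rho>"
        using H that j by simp
      then obtain f where f: "(d, f) \<in> dary d C" "subst_at ar 0 (insert_nth i c) H = rfun f"
        by (auto simp: \<rho>_def)
      have "rfun (\<lambda>xs\<in>nlists d A. H' (insert_nth i a xs)) = rfun f"
        unfolding f(2)[symmetric] rfun_restrict
        unfolding rfun_def subst_at_def c
      proof (intro restrict_ext)
        fix X assume "X \<in> box ar"
        then obtain x where x: "x \<in> nlists d {..<card A}" "X = [x]"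
          by (auto simp: in_box_single_iff)
        then show "H' (insert_nth i (e c) (map e (hd X))) = H (X[0 := insert_nth i c (X ! 0)])"
          using H'_map[OF insert_nth_in_nlists[OF x(1)], of c i] c(1) by (simp add: map_insert_nth)
      qed
      then have "(\<lambda>xs\<in>nlists d A. H' (insert_nth i a xs)) = f"
        using dC f(1) by (intro inj_onD[OF inj_on_rfun]) (auto simp: Op_def PiE_def)
      then show ?thesis
        using f(1) by simp
    qed
    have "H' xs \<in> A" if xs: "xs \<in> nlists (Suc d) A" for xs
    proof -
      obtain a ys where a: "a \<in> A" "ys \<in> nlists d A" "xs = insert_nth 0 a ys"
        using xs by (auto simp: in_nlists_Suc_iff insert_nth_def)
      have "(d, \<lambda>xs\<in>nlists d A. H' (insert_nth 0 a xs)) \<in> Op A"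
        using sect[OF _ a(1)] dC by blast
      then show ?thesis
        using a by (auto simp: Op_def PiE_iff split: if_splits)
    qed
    then have "(Suc d, H') \<in> Op A"
      by (auto simp: Op_def H'_def)
    moreover have "trl A d (Suc d, H') \<subseteq> dary d C"
    proof (rule trl_Suc_subset)
      fix i c assume "i \<le> d" "c \<in> A"
      then have "(d, \<lambda>xs\<in>nlists d A. H' (insert_nth i c xs)) \<in> C"
        using sect by (auto simp: dary_def)
      then show "trl A d (d, \<lambda>xs\<in>nlists d A. H' (insert_nth i c xs)) \<subseteq> dary d C"
        using C const by (intro trl_subset_clone)
    qed
    ultimately have H'_C: "(Suc d, H') \<in> C"
      using star by (auto simp: star_op_def)
    \<comment> \<open>The \<open>d\<close> projections with the \<open>i\<close>-th one repeated at
      place \<open>l\<close>; composing \<open>H'\<close> with them puts \<open>x ! i\<close> into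
      the additional argument.\<close>
    define gs where "gs = map (\<lambda>m. snd (proj_op A d m)) (insert_nth l i [0..<d])"
    have "(d, g) \<in> C" if "g \<in> set gs" for g
    proof -
      from that obtain m where "m < d" "g = snd (proj_op A d m)"
        using less_le_trans[OF i l] by (auto simp: gs_def)
      then have "(d, g) = proj_op A d m"
        by (simp add: proj_op_def)
      then show ?thesis
        using C \<open>m < d\<close> by (simp add: is_clone_def)
    qed
    then have "comp_op A d H' gs \<in> C"
      using C H'_C unfolding is_clone_def gs_def by (metis length_insert_nth length_map length_upt minus_nat.diff_0)
    moreover have "subst_at ar 0 (\<lambda>x. insert_nth l (x ! i) x) H = rfun (snd (comp_op A d H' gs))"
      unfolding comp_op_def snd_conv rfun_restrict
      unfolding rfun_def subst_at_def
    proof (intro restrict_ext)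
      fix X assume "X \<in> box ar"
      then obtain x where x: "x \<in> nlists d {..<card A}" "X = [x]"
        by (auto simp: in_box_single_iff)
      have len: "length x = d"
        using x by (simp add: in_nlists_iff)
      have "map (\<lambda>g. g (map e x)) gs = insert_nth l (map e x ! i) (map (\<lambda>m. map e x ! m) [0..<d])"
        using map_e_in_nlists[OF x(1)]
        by (simp add: gs_def map_insert_nth[symmetric] o_def proj_op_def del: nth_map)
      also have "map (\<lambda>m. map e x ! m) [0..<d] = map e x"
        using len map_nth[of "map e x"] by simp
      finally have "map (\<lambda>g. g (map e x)) gs = map e (insert_nth l (x ! i) x)"
        using len i l by (simp add: map_insert_nth)
      then show "H (X[0 := insert_nth l (X ! 0 ! i) (X ! 0)]) = H' (map (\<lambda>g. g (map e (hd X))) gs)"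
        using H'_map[OF insert_nth_in_nlists[OF x(1)], of "x ! i" l] nlistsE_nth_in[OF x(1), of i] x i l
        by simp
    qed
    ultimately show "subst_at ar j (\<lambda>x. insert_nth l (x ! i) x) H \<in> \<rho>"
      unfolding j \<rho>_def by (auto simp: dary_def comp_op_def)
  qed
  ultimately show ?thesis
    using sub unfolding ops_rrel_eq GQuord_def gen_quasiorder_def \<rho>_def by simp
qed

text \<open>Preserving the fragment means that composition with \<open>d\<close>-ary members of
  \<open>C\<close> stays in \<open>C\<close>. Projections and constants are such members, so all
  translations of a preserving operation lie in the fragment, and \<open>star\<close> places the
  operation in \<open>C\<close>.\<close>

lemma Pol_rrel_ops_rrel:
  assumes C: "is_clone A C" and const: "\<And>c. c \<in> A \<Longrightarrow> const_op A d c \<in> C"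
    and star: "star_op A d (dary d C) \<subseteq> C"
  shows "Pol_rrel A {ops_rrel e A d (dary d C)} = C"
proof -
  have CO: "C \<subseteq> Op A" and dC: "dary d C \<subseteq> Op A"
    using C by (auto simp: is_clone_def dary_def)
  have comp: "(\<lambda>X\<in>box ar. f (map (\<lambda>g. g X) (map rfun gs))) = rfun (snd (comp_op A d f gs))" for f gs
    unfolding comp_op_def snd_conv rfun_restrict
    unfolding rfun_def by (intro restrict_ext) (auto simp: o_def)
  have pres: "preserves_rrel (n, f) (ops_rrel e A d (dary d C)) \<longleftrightarrow>
      (\<forall>gs. length gs = n \<and> (\<forall>g\<in>set gs. (d, g) \<in> C) \<longrightarrow> comp_op A d f gs \<in> C)" for n f
  proof -
    have lists: "(\<forall>rs. length rs = n \<and> set rs \<subseteq> rfun ` S \<longrightarrow> P rs) \<longleftrightarrow>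
        (\<forall>gs. length gs = n \<and> set gs \<subseteq> S \<longrightarrow> P (map rfun gs))" for P S
      using lists_image[of rfun S] unfolding lists_eq_set
      by (auto simp: set_eq_iff image_iff) (metis length_map)
    have S: "{rfun f | f. (d, f) \<in> dary d C} = rfun ` {f. (d, f) \<in> C}"
      by (auto simp: dary_def)
    have mem: "rfun (snd (comp_op A d f gs)) \<in> rfun ` {f. (d, f) \<in> C} \<longleftrightarrow> comp_op A d f gs \<in> C" for gs
      using rfun_mem_iff[OF dC, of "snd (comp_op A d f gs)"] unfolding S
      by (simp add: comp_op_def dary_def)
    show ?thesis
      unfolding ops_rrel_eq preserves_rrel_def prod.case S lists comp mem by auto
  qed
  show ?thesis
  proof (intro equalityI subrelI)
    fix n f assume "(n, f) \<in> Pol_rrel A {ops_rrel e A d (dary d C)}"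
    then have Op: "(n, f) \<in> Op A" and *: "\<And>gs. length gs = n \<Longrightarrow> (\<forall>g\<in>set gs. (d, g) \<in> C) \<Longrightarrow> comp_op A d f gs \<in> C"
      using pres by (auto simp: Pol_rrel_def)
    have "trl A d (n, f) \<subseteq> dary d C"
    proof
      fix q assume "q \<in> trl A d (n, f)"
      then obtain gs where gs: "length gs = n" "q = comp_op A d f gs"
        "\<And>g. g \<in> set gs \<Longrightarrow> (\<exists>i<d. (d, g) = proj_op A d i) \<or> (\<exists>c\<in>A. (d, g) = const_op A d c)"
        using trl_comp_op by blast
      have "(d, g) \<in> C" if "g \<in> set gs" for g
        using gs(3)[OF that] C const unfolding is_clone_def by metis
      then have "q \<in> C"
        using * gs(1,2) by blast
      then show "q \<in> dary d C"
        unfolding gs(2) by (simp add: dary_def comp_op_def)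
    qed
    then show "(n, f) \<in> C"
      using Op star by (auto simp: star_op_def)
  next
    fix n f assume "(n, f) \<in> C"
    then show "(n, f) \<in> Pol_rrel A {ops_rrel e A d (dary d C)}"
      using C CO pres by (auto simp: Pol_rrel_def is_clone_def)
  qed
qed

end

section \<open>Preservation of generalized quasiorders\<close>

lemma fill_append:
  "count_list p None \<le> length xs \<Longrightarrow>
     fill (p @ q) xs = fill p (take (count_list p None) xs) @ fill q (drop (count_list p None) xs)"
proof (induction p xs rule: fill.induct)
  case (3 p xs)
  then show ?case by (cases xs) auto
qed auto

lemma fill_snoc_None:
  "length xs = count_list p None \<Longrightarrow> fill (p @ [None]) (xs @ [y]) = fill p xs @ [y]"
  by (simp add: fill_append)

lemma fill_snoc_Some:
  "length xs = count_list p None \<Longrightarrow> fill (p @ [Some c]) xs = fill p xs @ [c]"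
  by (simp add: fill_append)

text \<open>Since the variables are consumed in order, a block of the filled list sees an interval
  of \<open>xs\<close>, offset by the number of variables kept before the block.\<close>

lemma fill_block:
  assumes "count_list p None \<le> length xs"
  shows "take k (drop m (fill p xs)) =
    fill (take k (drop m p)) (take (count_list (take k (drop m p)) None)
      (drop (count_list (take m p) None) xs))"
proof -
  let ?p1 = "take m p" and ?p2 = "take k (drop m p)" and ?p3 = "drop k (drop m p)"
  have p: "p = ?p1 @ ?p2 @ ?p3"
    by (simp only: append_take_drop_id)
  have count: "count_list p None = count_list ?p1 None + count_list ?p2 None + count_list ?p3 None"
    by (subst p) (simp only: count_list_append)
  have "fill p xs = fill (?p1 @ ?p2 @ ?p3) xs"
    using p by simp
  also have "\<dots> = fill ?p1 (take (count_list ?p1 None) xs) @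
      fill ?p2 (take (count_list ?p2 None) (drop (count_list ?p1 None) xs)) @
      fill ?p3 (drop (count_list ?p2 None) (drop (count_list ?p1 None) xs))"
    using assms count by (simp add: fill_append)
  finally show ?thesis
    by (cases "m \<le> length p"; cases "k \<le> length p - m") (auto simp: min_absorb2)
qed

lemma sum_count_list_blocks:
  "(\<Sum>i<n. count_list (take k (drop (i * k) p)) x) = count_list (take (n * k) p) x"
proof (induction n)
  case (Suc n)
  have "take (Suc n * k) p = take (n * k) p @ take k (drop (n * k) p)"
    by (metis add.commute mult_Suc take_add)
  then show ?case
    using Suc by simp
qed simp

text \<open>Separates the varying entries, selected by \<open>I\<close>, from the constant ones, so
  that \<open>f\<close> can be read as a translation applied to the former.\<close>

lemma fill_filter:
  "fill (map (\<lambda>i. if I i then None else Some (c i)) is) (map F (filter I is)) =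
     map (\<lambda>i. if I i then F i else c i) is"
  by (induction "is") auto

lemma count_list_None_filter:
  "count_list (map (\<lambda>i. if I i then None else Some (c i)) is) None = length (filter I is)"
  by (induction "is") auto

lemma count_list_eq_length: "count_list p x = length p \<Longrightarrow> p = replicate (length p) x"
proof (induction p)
  case (Cons a p)
  then show ?case
    using count_le_length[of p x] by (auto split: if_splits)
qed simp

text \<open>The \<open>l\<close>-th \<open>None\<close> of the pattern is turned into
  \<open>Some c\<close>; thus a section of a restriction is again given by a pattern.\<close>

lemma fill_insert_nth_substitute:
  assumes "l < count_list p None"
  shows "\<exists>p'. length p' = length p \<and> Suc (count_list p' None) = count_list p None \<and>
    (\<forall>a. Some a \<in> set p' \<longrightarrow> a = c \<or> Some a \<in> set p) \<and>
    (\<forall>xs. Suc (length xs) = count_list p None \<longrightarrow> fill p (insert_nth l c xs) = fill p' xs)"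
  using assms
proof (induction p arbitrary: l)
  case (Cons a p)
  show ?case
  proof (cases a)
    case (Some b)
    then have "l < count_list p None"
      using Cons.prems by simp
    from Cons.IH[OF this] obtain p' where p': "length p' = length p \<and> Suc (count_list p' None) = count_list p None \<and>
        (\<forall>a. Some a \<in> set p' \<longrightarrow> a = c \<or> Some a \<in> set p) \<and>
        (\<forall>xs. Suc (length xs) = count_list p None \<longrightarrow> fill p (insert_nth l c xs) = fill p' xs)"
      by blast
    then show ?thesis
      using Some by (intro exI[of _ "Some b # p'"]) auto
  next
    case None
    show ?thesis
    proof (cases l)
      case 0
      then show ?thesis
        using None by (intro exI[of _ "Some c # p"]) (auto simp: insert_nth_def)
    next
      case (Suc l')
      then have "l' < count_list p None"
        using Cons.prems None by simp
      from Cons.IH[OF this] obtain p' where p': "length p' = length p \<and> Suc (count_list p' None) = count_list p None \<and>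
          (\<forall>a. Some a \<in> set p' \<longrightarrow> a = c \<or> Some a \<in> set p) \<and>
          (\<forall>xs. Suc (length xs) = count_list p None \<longrightarrow> fill p (insert_nth l' c xs) = fill p' xs)"
        by blast
      have "fill (a # p) (insert_nth l c xs) = fill (None # p') xs"
        if len: "Suc (length xs) = count_list (a # p) None" for xs
      proof -
        have "length xs = Suc (count_list p' None)"
          using len p' None by simp
        then obtain y ys where "xs = y # ys"
          by (cases xs) auto
        then show ?thesis
          using p' len None Suc by (auto simp: insert_nth_def)
      qed
      then show ?thesis
        using p' None by (intro exI[of _ "None # p'"]) auto
    qed
  qed
qed simp

text \<open>A point of the box supplies the values of arguments that have lost all variables,
  positive exponents make remainders modulo an exponent valid indices, and an element of
  \<open>A\<close> yields a member of \<open>\<rho>\<close> for padding.\<close>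

locale generalized_quasiorder =
  fixes A :: "'a set" and \<alpha> :: "'b arity" and \<rho> :: "('b list list \<Rightarrow> 'a) set"
  assumes gen_quasiorder: "gen_quasiorder A (\<alpha>, \<rho>)"
    and box_not_empty: "box \<alpha> \<noteq> {}"
    and exponent_pos: "j < length \<alpha> \<Longrightarrow> snd (\<alpha> ! j) \<ge> 1"
    and A_not_empty: "A \<noteq> {}"
begin

abbreviation (input) base :: "nat \<Rightarrow> 'b set" where
  "base j \<equiv> fst (\<alpha> ! j)"

abbreviation (input) expo :: "nat \<Rightarrow> nat" where
  "expo j \<equiv> snd (\<alpha> ! j)"

section \<open>Constants substituted into members of a generalized quasiorder\<close>

lemma sub: "\<rho> \<subseteq> box \<alpha> \<rightarrow>\<^sub>E A"
  using gen_quasiorder by (simp add: gen_quasiorder_def)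

lemma const_mem: "c \<in> A \<Longrightarrow> (\<lambda>X\<in>box \<alpha>. c) \<in> \<rho>"
  using gen_quasiorder by (simp add: gen_quasiorder_def)

lemma mem_values: "g \<in> \<rho> \<Longrightarrow> X \<in> box \<alpha> \<Longrightarrow> g X \<in> A"
  using sub by (auto simp: PiE_iff)

lemma tl_mem:
  "j < length \<alpha> \<Longrightarrow> g \<in> \<rho> \<Longrightarrow> i \<le> expo j \<Longrightarrow> c \<in> base j \<Longrightarrow>
     subst_at \<alpha> j (\<lambda>x. tl (insert_nth i c x)) g \<in> \<rho>"
  using gen_quasiorder int_reflexive_iff[OF sub] by (simp add: gen_quasiorder_def)

lemma butlast_mem:
  "j < length \<alpha> \<Longrightarrow> g \<in> \<rho> \<Longrightarrow> i \<le> expo j \<Longrightarrow> c \<in> base j \<Longrightarrow>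
     subst_at \<alpha> j (\<lambda>x. butlast (insert_nth i c x)) g \<in> \<rho>"
  using gen_quasiorder int_reflexive_iff[OF sub] by (simp add: gen_quasiorder_def)

lemma identify_mem:
  assumes "j < length \<alpha>"
    and "\<And>i c. i \<le> expo j \<Longrightarrow> c \<in> base j \<Longrightarrow> subst_at \<alpha> j (insert_nth i c) H \<in> \<rho>"
    and "l \<le> expo j" and "i < l"
  shows "subst_at \<alpha> j (\<lambda>x. insert_nth l (x ! i) x) H \<in> \<rho>"
  using gen_quasiorder transitive_iff[OF sub] assms by (simp add: gen_quasiorder_def)

lemma nth_in_nlists: "X \<in> box \<alpha> \<Longrightarrow> j < length \<alpha> \<Longrightarrow> X ! j \<in> nlists (expo j) (base j)"
  by (simp add: in_box_iff)

lemma subst_at_subst_at: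
  assumes "j < length \<alpha>" and "\<And>x. x \<in> nlists (expo j) (base j) \<Longrightarrow> \<phi> x \<in> nlists (expo j) (base j)"
  shows "subst_at \<alpha> j \<phi> (subst_at \<alpha> j \<psi> g) = subst_at \<alpha> j (\<lambda>x. \<psi> (\<phi> x)) g"
  unfolding subst_at_def
proof (intro restrict_ext)
  fix X assume X: "X \<in> box \<alpha>"
  have "X[j := \<phi> (X ! j)] \<in> box \<alpha>"
    using X assms nth_in_nlists by (intro list_update_in_box) auto
  then show "restrict (\<lambda>X. g (X[j := \<psi> (X ! j)])) (box \<alpha>) (X[j := \<phi> (X ! j)]) = g (X[j := \<psi> (\<phi> (X ! j))])"
    using assms(1) length_of_box[OF X] by simp
qed

lemma window_in_nlists:
  assumes "length q = k" and "\<And>c. Some c \<in> set q \<Longrightarrow> c \<in> B" and "u + count_list q None \<le> length x"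
    and "set x \<subseteq> B"
  shows "fill q (take (count_list q None) (drop u x)) \<in> nlists k B"
proof (rule fill_in_nlists)
  show "set (take (count_list q None) (drop u x)) \<subseteq> B"
    using assms(4) set_take_subset[of _ "drop u x"] set_drop_subset[of u x] by fastforce
qed (use assms in auto)

text \<open>
  Inserting a constant and dropping the first or the last variable trades an outer variable of the
  window \<open>take t (drop u x)\<close> for a constant.
\<close>

lemma window_mem:
  assumes "j < length \<alpha>" and "g \<in> \<rho>" and "length q = expo j"
    and "\<And>c. Some c \<in> set q \<Longrightarrow> c \<in> base j" and "u + count_list q None \<le> expo j"
  shows "subst_at \<alpha> j (\<lambda>x. fill q (take (count_list q None) (drop u x))) g \<in> \<rho>"
  using assms(2-)
proof (induction "expo j - count_list q None" arbitrary: q u g)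
  case 0
  then have count: "count_list q None = expo j" and "u = 0"
    by auto
  have q: "q = replicate (expo j) None"
    using count_list_eq_length[of q None] count 0(3) by simp
  have "subst_at \<alpha> j (\<lambda>x. fill q (take (count_list q None) (drop u x))) g = g"
  proof (rule extensionalityI)
    fix X assume X: "X \<in> box \<alpha>"
    then have "length (X ! j) = expo j"
      using nth_in_nlists[OF X assms(1)] by (simp add: in_nlists_iff)
    then show "subst_at \<alpha> j (\<lambda>x. fill q (take (count_list q None) (drop u x))) g X = g X"
      using X count \<open>u = 0\<close> by (simp add: subst_at_def q fill_replicate_None)
  qed (use 0(2) sub in \<open>auto simp: subst_at_def PiE_def\<close>)
  then show ?case
    using 0(2) by simp
next
  case (Suc m)
  let ?t = "count_list q None"
  have "count_list q None < length q"
    using Suc.hyps(2) Suc.prems(2) by simp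
  then obtain i c where i: "i < length q" and c: "q ! i = Some c"
    using count_list_less_length[of q None] by auto
  define q0 where "q0 = delete_nth i q"
  have q: "q = insert_nth i (Some c) q0"
    using insert_nth_delete_nth[OF i] c by (simp add: q0_def)
  have len: "length q0 = expo j - 1" "i \<le> length q0" "expo j \<ge> 1"
    using i Suc.prems(2) by (auto simp: q0_def length_delete_nth)
  have t: "count_list q0 None = ?t"
    by (simp add: q count_list_insert_nth)
  have cB: "c \<in> base j" and q0B: "\<And>a. Some a \<in> set q0 \<Longrightarrow> a \<in> base j"
    using Suc.prems(3) by (auto simp: q)
  show ?case
  proof (cases "u > 0")
    case True
    \<comment> \<open>A variable precedes the window, which can thus be enlarged to the front. The
      pattern \<open>?q\<close> has one constant fewer; its additional first variable is removed by
      \<open>tl\<close>, so \<open>c\<close> is inserted at \<open>Suc i\<close> to end up at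
      \<open>i\<close>.\<close>
    let ?q = "None # q0" and ?\<phi> = "\<lambda>x. fill (None # q0) (take (count_list (None # q0) None) (drop (u - 1) x))"
    have pre: "length ?q = expo j" "\<And>a. Some a \<in> set ?q \<Longrightarrow> a \<in> base j"
        "u - 1 + count_list ?q None \<le> expo j" "m = expo j - count_list ?q None"
      using len t q0B True Suc.prems(4) Suc.hyps(2) by auto
    have "subst_at \<alpha> j ?\<phi> (subst_at \<alpha> j (\<lambda>x. tl (insert_nth (Suc i) c x)) g) \<in> \<rho>"
      using Suc.hyps(1)[OF pre(4) tl_mem[OF assms(1) Suc.prems(1) _ cB] pre(1-3)] len by simp
    also have "subst_at \<alpha> j ?\<phi> (subst_at \<alpha> j (\<lambda>x. tl (insert_nth (Suc i) c x)) g) =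
        subst_at \<alpha> j (\<lambda>x. tl (insert_nth (Suc i) c (?\<phi> x))) g"
      using pre by (intro subst_at_subst_at assms(1) window_in_nlists) (auto simp: in_nlists_iff)
    also have "\<dots> = subst_at \<alpha> j (\<lambda>x. fill q (take ?t (drop u x))) g"
      unfolding subst_at_def
    proof (intro restrict_ext arg_cong[of _ _ g] arg_cong2[of _ _ _ _ "\<lambda>X x. X[j := x]"] refl)
      fix X assume X: "X \<in> box \<alpha>"
      have "length (X ! j) = expo j"
        using nth_in_nlists[OF X assms(1)] by (simp add: in_nlists_iff)
      then have "drop (u - 1) (X ! j) = X ! j ! (u - 1) # drop u (X ! j)"
        using Cons_nth_drop_Suc[of "u - 1" "X ! j"] True Suc.prems(4) len by auto
      then have "?\<phi> (X ! j) = X ! j ! (u - 1) # fill q0 (take ?t (drop u (X ! j)))"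
        by (simp add: t)
      then show "tl (insert_nth (Suc i) c (?\<phi> (X ! j))) = fill q (take ?t (drop u (X ! j)))"
        using len by (simp only: q fill_insert_nth_Some) (simp add: insert_nth_def)
    qed
    finally show ?thesis .
  next
    case False
    \<comment> \<open>With \<open>u = 0\<close> the window, being shorter than the list, is followed
      by a variable. It is kept last in \<open>?q\<close> and removed by
      \<open>butlast\<close>.\<close>
    let ?q = "q0 @ [None]" and ?\<phi> = "\<lambda>x. fill (q0 @ [None]) (take (count_list (q0 @ [None]) None) (drop u x))"
    have pre: "length ?q = expo j" "\<And>a. Some a \<in> set ?q \<Longrightarrow> a \<in> base j"
        "u + count_list ?q None \<le> expo j" "m = expo j - count_list ?q None"
      using len t q0B False Suc.prems(4) Suc.hyps(2) by auto
    have "subst_at \<alpha> j ?\<phi> (subst_at \<alpha> j (\<lambda>x. butlast (insert_nth i c x)) g) \<in> \<rho>"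
      using Suc.hyps(1)[OF pre(4) butlast_mem[OF assms(1) Suc.prems(1) _ cB] pre(1-3)] len by simp
    also have "subst_at \<alpha> j ?\<phi> (subst_at \<alpha> j (\<lambda>x. butlast (insert_nth i c x)) g) =
        subst_at \<alpha> j (\<lambda>x. butlast (insert_nth i c (?\<phi> x))) g"
      using pre by (intro subst_at_subst_at assms(1) window_in_nlists) (auto simp: in_nlists_iff)
    also have "\<dots> = subst_at \<alpha> j (\<lambda>x. fill q (take ?t (drop u x))) g"
      unfolding subst_at_def
    proof (intro restrict_ext arg_cong[of _ _ g] arg_cong2[of _ _ _ _ "\<lambda>X x. X[j := x]"] refl)
      fix X assume X: "X \<in> box \<alpha>"
      have lenX: "length (X ! j) = expo j"
        using nth_in_nlists[OF X assms(1)] by (simp add: in_nlists_iff)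
      have "take (Suc ?t) (drop u (X ! j)) = take ?t (drop u (X ! j)) @ [X ! j ! (u + ?t)]"
        using lenX Suc.hyps(2) False by (subst take_Suc_conv_app_nth) auto
      then have "?\<phi> (X ! j) = fill q0 (take ?t (drop u (X ! j))) @ [X ! j ! (u + ?t)]"
        using lenX Suc.hyps(2) False t by (simp add: fill_snoc_None)
      then show "butlast (insert_nth i c (?\<phi> (X ! j))) = fill q (take ?t (drop u (X ! j)))"
        using len by (simp only: q fill_insert_nth_Some) (simp add: insert_nth_def butlast_append)
    qed
    finally show ?thesis .
  qed
qed

text \<open>The substitutions concern different coordinates and can be made one after another;
  \<open>G k\<close> has made those in the coordinates below \<open>k\<close>.\<close>

lemma multi_subst_mem:
  assumes "g \<in> \<rho>"
    and \<phi>: "\<And>j x. j < length \<alpha> \<Longrightarrow> x \<in> nlists (expo j) (base j) \<Longrightarrow> \<phi> j x \<in> nlists (expo j) (base j)"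
    and mem: "\<And>j g. j < length \<alpha> \<Longrightarrow> g \<in> \<rho> \<Longrightarrow> subst_at \<alpha> j (\<phi> j) g \<in> \<rho>"
  shows "(\<lambda>X\<in>box \<alpha>. g (map (\<lambda>j. \<phi> j (X ! j)) [0..<length \<alpha>])) \<in> \<rho>"
proof -
  define G where "G k = (\<lambda>X\<in>box \<alpha>. g (map (\<lambda>j. if j < k then \<phi> j (X ! j) else X ! j) [0..<length \<alpha>]))" for k
  have "G k \<in> \<rho>" if "k \<le> length \<alpha>" for k
    using that
  proof (induction k)
    case 0
    have "G 0 = g"
    proof (rule extensionalityI)
      fix X assume "X \<in> box \<alpha>"
      then show "G 0 X = g X"
        using map_nth[of X] by (simp add: G_def length_of_box)
    qed (use assms(1) sub in \<open>auto simp: G_def PiE_def\<close>)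
    then show ?case
      using assms(1) by simp
  next
    case (Suc k)
    then have "subst_at \<alpha> k (\<phi> k) (G k) \<in> \<rho>"
      by (intro mem) auto
    also have "subst_at \<alpha> k (\<phi> k) (G k) = G (Suc k)"
      unfolding subst_at_def G_def[of "Suc k"]
    proof (intro restrict_ext)
      fix X assume X: "X \<in> box \<alpha>"
      have "X[k := \<phi> k (X ! k)] \<in> box \<alpha>"
        using X nth_in_nlists \<phi> by (intro list_update_in_box) auto
      then have "G k (X[k := \<phi> k (X ! k)]) =
          g (map (\<lambda>j. if j < k then \<phi> j (X[k := \<phi> k (X ! k)] ! j) else X[k := \<phi> k (X ! k)] ! j) [0..<length \<alpha>])"
        by (simp add: G_def)
      also have "map (\<lambda>j. if j < k then \<phi> j (X[k := \<phi> k (X ! k)] ! j) else X[k := \<phi> k (X ! k)] ! j) [0..<length \<alpha>]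
          = map (\<lambda>j. if j < Suc k then \<phi> j (X ! j) else X ! j) [0..<length \<alpha>]"
        using length_of_box[OF X] Suc.prems by (auto simp: nth_list_update less_Suc_eq)
      finally show "G k (X[k := \<phi> k (X ! k)]) =
          g (map (\<lambda>j. if j < Suc k then \<phi> j (X ! j) else X ! j) [0..<length \<alpha>])" .
    qed
    finally show ?case .
  qed
  then have "G (length \<alpha>) \<in> \<rho>"
    by simp
  also have "G (length \<alpha>) = (\<lambda>X\<in>box \<alpha>. g (map (\<lambda>j. \<phi> j (X ! j)) [0..<length \<alpha>]))"
    unfolding G_def by (intro restrict_ext arg_cong[of _ _ g]) simp
  finally show ?thesis .
qed

section \<open>Functions with separated variables\<close>

text \<open>
  For a function \<open>h\<close> with \<open>N j\<close> variables of the \<open>j\<close>-th sort, \<open>restrictions_mem N h\<close> says that keeping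
  exactly as many variables of each sort as in \<open>\<alpha>\<close> and substituting constants for the others always
  gives a member of \<open>\<rho>\<close>.
\<close>

definition patterns :: "(nat \<Rightarrow> nat) \<Rightarrow> (nat \<Rightarrow> 'b option list) set" where
  "patterns N = {p. \<forall>j<length \<alpha>. length (p j) = N j \<and> count_list (p j) None = expo j \<and>
     (\<forall>c. Some c \<in> set (p j) \<longrightarrow> c \<in> base j)}"

definition restrictions_mem :: "(nat \<Rightarrow> nat) \<Rightarrow> ('b list list \<Rightarrow> 'a) \<Rightarrow> bool" where
  "restrictions_mem N h \<longleftrightarrow>
     (\<forall>p\<in>patterns N. (\<lambda>X\<in>box \<alpha>. h (map (\<lambda>j. fill (p j) (X ! j)) [0..<length \<alpha>])) \<in> \<rho>)"

text \<open>Argument \<open>i\<close> of \<open>f\<close> owns, for each sort \<open>j\<close>, the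
  \<open>expo j\<close> variables from index \<open>i * expo j\<close> on. The restricted function
  is exhibited as a translation of \<open>f\<close> applied to as many members of
  \<open>\<rho>\<close> as the dimension says.\<close>

lemma restrictions_mem_blocks:
  assumes Op: "(n, f) \<in> Op A" and trl: "\<And>q. q \<in> trl A (dimension \<alpha>) (n, f) \<Longrightarrow> preserves_rrel q (\<alpha>, \<rho>)"
    and gs: "set gs \<subseteq> \<rho>" "length gs = n"
  shows "restrictions_mem (\<lambda>j. n * expo j)
    (\<lambda>Y. f (map (\<lambda>i. (gs ! i) (map (\<lambda>j. take (expo j) (drop (i * expo j) (Y ! j))) [0..<length \<alpha>])) [0..<n]))"
  unfolding restrictions_mem_def
proof
  fix p assume p: "p \<in> patterns (\<lambda>j. n * expo j)"
  let ?d = "dimension \<alpha>"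
  have p_len: "length (p j) = n * expo j" and p_count: "count_list (p j) None = expo j"
    and p_base: "\<And>c. Some c \<in> set (p j) \<Longrightarrow> c \<in> base j" if "j < length \<alpha>" for j
    using p that by (auto simp: patterns_def)
  \<comment> \<open>\<open>q i j\<close> is the part of the pattern in block \<open>i\<close> of
    sort \<open>j\<close>; it keeps \<open>t i j\<close> variables, and earlier blocks keep
    \<open>u i j\<close>. So \<open>gs ! i\<close> sees only the window of \<open>t i j\<close>
    variables after the first \<open>u i j\<close>.\<close>
  define q where "q i j = take (expo j) (drop (i * expo j) (p j))" for i j
  define t where "t i j = count_list (q i j) None" for i j
  define u where "u i j = count_list (take (i * expo j) (p j)) None" for i j
  define G where "G i = (\<lambda>X\<in>box \<alpha>. (gs ! i) (map (\<lambda>j. fill (q i j) (take (t i j) (drop (u i j) (X ! j))))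
    [0..<length \<alpha>]))" for i
  have q_len: "length (q i j) = expo j" if "i < n" "j < length \<alpha>" for i j
  proof -
    have "Suc i * expo j \<le> n * expo j"
      using that(1) by (intro mult_le_mono1) simp
    then show ?thesis
      using p_len[OF that(2)] by (simp add: q_def)
  qed
  have q_base: "c \<in> base j" if "Some c \<in> set (q i j)" "j < length \<alpha>" for c i j
    using that p_base unfolding q_def by (meson in_set_dropD in_set_takeD)
  have ut: "u i j + t i j \<le> expo j" if "j < length \<alpha>" for i j
  proof -
    have "u i j + t i j = count_list (take (i * expo j + expo j) (p j)) None"
      by (simp add: u_def t_def q_def take_add)
    also have "\<dots> \<le> count_list (p j) None"
      by (metis append_take_drop_id count_list_append le_add1)
    finally show ?thesis
      by (simp add: p_count[OF that])
  qed
  have G_mem: "G i \<in> \<rho>" if "i < n" for i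
    unfolding G_def
  proof (rule multi_subst_mem)
    show "gs ! i \<in> \<rho>"
      using gs that by auto
    fix j assume j: "j < length \<alpha>"
    show "subst_at \<alpha> j (\<lambda>x. fill (q i j) (take (t i j) (drop (u i j) x))) g \<in> \<rho>" if "g \<in> \<rho>" for g
      using j q_len[OF \<open>i < n\<close> j] q_base[OF _ j] ut[OF j] that unfolding t_def by (intro window_mem)
    show "fill (q i j) (take (t i j) (drop (u i j) x)) \<in> nlists (expo j) (base j)"
      if "x \<in> nlists (expo j) (base j)" for x
      using q_len[OF \<open>i < n\<close> j] q_base[OF _ j] ut[OF j, of i] that unfolding t_def
      by (intro window_in_nlists) (auto simp: in_nlists_iff)
  qed
  obtain X0 where X0: "X0 \<in> box \<alpha>"
    using box_not_empty by blast
  \<comment> \<open>\<open>I i\<close> says that argument \<open>i\<close> keeps a variable.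
    Otherwise \<open>G i\<close> is constant, and its value can be read off at the arbitrary point
    \<open>X0\<close>.\<close>
  define I where "I i \<longleftrightarrow> (\<exists>j<length \<alpha>. t i j > 0)" for i
  define c where "c i = G i X0" for i
  have c_A: "c i \<in> A" if "i < n" for i
    using mem_values[OF G_mem[OF that] X0] by (simp add: c_def)
  have G_c: "G i X = c i" if "\<not> I i" "X \<in> box \<alpha>" for i X
  proof -
    have "fill (q i j) (take (t i j) (drop (u i j) (X ! j))) = fill (q i j) (take (t i j) (drop (u i j) (X0 ! j)))"
      if "j < length \<alpha>" for j
      using that \<open>\<not> I i\<close> by (simp add: I_def)
    then have "map (\<lambda>j. fill (q i j) (take (t i j) (drop (u i j) (X ! j)))) [0..<length \<alpha>] =
        map (\<lambda>j. fill (q i j) (take (t i j) (drop (u i j) (X0 ! j)))) [0..<length \<alpha>]"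
      by (intro map_cong) auto
    then show ?thesis
      unfolding G_def c_def restrict_apply using that(2) X0 by (simp only: if_True)
  qed
  define ids where "ids = filter I [0..<n]"
  have ids_le: "length ids \<le> ?d"
  proof -
    have "length ids = (\<Sum>i<n. if I i then 1 else 0)"
      unfolding ids_def by (induction n) auto
    \<comment> \<open>Each argument counted in \<open>ids\<close> keeps at least one variable, and
      over all blocks exactly \<open>expo j\<close> variables of sort \<open>j\<close> are
      kept.\<close>
    also have "\<dots> \<le> (\<Sum>i<n. \<Sum>j<length \<alpha>. t i j)"
    proof (rule sum_mono)
      fix i
      show "(if I i then 1 else 0) \<le> (\<Sum>j<length \<alpha>. t i j)"
      proof (cases "I i")
        case True
        then obtain j where j: "j < length \<alpha>" "t i j > 0"
          by (auto simp: I_def)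
        then have "t i j \<le> (\<Sum>j<length \<alpha>. t i j)"
          by (intro member_le_sum) auto
        then show ?thesis
          using j by simp
      qed simp
    qed
    also have "\<dots> = (\<Sum>j<length \<alpha>. \<Sum>i<n. t i j)"
      by (rule sum.swap)
    also have "\<dots> = (\<Sum>j<length \<alpha>. expo j)"
      using p_len p_count by (intro sum.cong) (simp_all add: t_def q_def sum_count_list_blocks)
    also have "\<dots> = ?d"
      by (simp add: dimension_def sum_list_sum_nth atLeast0LessThan)
    finally show ?thesis .
  qed
  define P where "P = map (\<lambda>i. if I i then None else Some (c i)) [0..<n]"
  define f' where "f' = (\<lambda>xs\<in>nlists ?d A. f (fill P (take (length ids) (drop 0 xs))))"
  have "(?d, f') \<in> trl A ?d (n, f)"
    unfolding f'_def
  proof (rule trlI[where u = 0])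
    show "count_list P None = length ids"
      by (simp add: P_def ids_def count_list_None_filter)
    show "a \<in> A" if "Some a \<in> set P" for a
      using that c_A by (auto simp: P_def split: if_splits)
  qed (use ids_le in \<open>auto simp: P_def\<close>)
  then have pres: "preserves_rrel (?d, f') (\<alpha>, \<rho>)"
    by (rule trl)
  \<comment> \<open>The translation has arity \<open>?d\<close>, but only its first
    \<open>length ids\<close> variables enter \<open>f\<close>; the other places are filled with
    \<open>g0\<close>.\<close>
  obtain g0 where g0: "g0 \<in> \<rho>"
    using const_mem A_not_empty by blast
  define hs where "hs = map G ids @ replicate (?d - length ids) g0"
  have hs: "length hs = ?d" "set hs \<subseteq> \<rho>"
    using ids_le g0 G_mem by (auto simp: hs_def ids_def)
  have "(\<lambda>X\<in>box \<alpha>. f' (map (\<lambda>g. g X) hs)) \<in> \<rho>"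
    using pres hs by (auto simp: preserves_rrel_def)
  also have "(\<lambda>X\<in>box \<alpha>. f' (map (\<lambda>g. g X) hs)) = (\<lambda>X\<in>box \<alpha>. f (map (\<lambda>i. (gs ! i)
      (map (\<lambda>j. take (expo j) (drop (i * expo j)
        (map (\<lambda>j. fill (p j) (X ! j)) [0..<length \<alpha>] ! j))) [0..<length \<alpha>])) [0..<n]))"
  proof (intro restrict_ext)
    fix X assume X: "X \<in> box \<alpha>"
    have "map (\<lambda>g. g X) hs \<in> nlists ?d A"
      using hs mem_values[OF _ X] by (auto simp: in_nlists_iff)
    then have "f' (map (\<lambda>g. g X) hs) = f (fill P (map (\<lambda>i. G i X) ids))"
      by (simp add: f'_def hs_def o_def)
    also have "fill P (map (\<lambda>i. G i X) ids) = map (\<lambda>i. G i X) [0..<n]"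
      unfolding P_def ids_def fill_filter using G_c[OF _ X] by simp
    also have "map (\<lambda>i. G i X) [0..<n] = map (\<lambda>i. (gs ! i)
      (map (\<lambda>j. take (expo j) (drop (i * expo j)
        (map (\<lambda>j. fill (p j) (X ! j)) [0..<length \<alpha>] ! j))) [0..<length \<alpha>])) [0..<n]"
    proof -
      have "take (expo j) (drop (i * expo j) (map (\<lambda>j. fill (p j) (X ! j)) [0..<length \<alpha>] ! j)) =
          fill (q i j) (take (t i j) (drop (u i j) (X ! j)))" if j: "j < length \<alpha>" for i j
        using j p_count[OF j] nth_in_nlists[OF X j]
        by (simp add: in_nlists_iff fill_block q_def t_def u_def)
      then show ?thesis
        unfolding G_def restrict_apply'[OF X]
        by (intro map_cong refl arg_cong[of _ _ "gs ! _"]) simp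
    qed
    finally show "f' (map (\<lambda>g. g X) hs) = f (map (\<lambda>i. (gs ! i)
      (map (\<lambda>j. take (expo j) (drop (i * expo j)
        (map (\<lambda>j. fill (p j) (X ! j)) [0..<length \<alpha>] ! j))) [0..<length \<alpha>])) [0..<n])" .
  qed
  finally show "(\<lambda>X\<in>box \<alpha>. f (map (\<lambda>i. (gs ! i)
      (map (\<lambda>j. take (expo j) (drop (i * expo j)
        (map (\<lambda>j. fill (p j) (X ! j)) [0..<length \<alpha>] ! j))) [0..<length \<alpha>])) [0..<n])) \<in> \<rho>" .
qed

text \<open>A pattern for \<open>m\<close> variables has to be extended to the variable that is
  identified with variable \<open>i\<close>. If variable \<open>i\<close> is fixed to a constant,
  the same constant is appended. If it is kept, so is the last one; this is one variable too many,
  and transitivity applies.\<close>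

lemma restrictions_mem_identify:
  assumes h: "restrictions_mem (N(j := Suc m)) h" and j: "j < length \<alpha>" and i: "i < m"
  shows "restrictions_mem (N(j := m)) (\<lambda>Y. h (Y[j := Y ! j @ [Y ! j ! i]]))"
  unfolding restrictions_mem_def
proof
  fix p assume p: "p \<in> patterns (N(j := m))"
  define F where "F q X = map (\<lambda>k. fill (q k) (X ! k)) [0..<length \<alpha>]"
    for q :: "nat \<Rightarrow> 'b option list" and X
  let ?q = "p j"
  have q: "length ?q = m" "count_list ?q None = expo j" "\<And>c. Some c \<in> set ?q \<Longrightarrow> c \<in> base j"
    using p j by (auto simp: patterns_def)
  have upd: "p(j := r) \<in> patterns (N(j := Suc m))"
    if "length r = Suc m" "count_list r None = expo j" "\<And>c. Some c \<in> set r \<Longrightarrow> c \<in> base j" for r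
    using p that by (auto simp: patterns_def)
  have F_upd: "(F p X)[j := fill r x] = F (p(j := r)) (X[j := x])" if "X \<in> box \<alpha>" for r x X
    using length_of_box[OF that] j unfolding F_def by (intro nth_equalityI) (auto simp: nth_list_update)
  have F_nth: "F p X ! j = fill ?q (X ! j)" for X
    using j by (simp add: F_def)
  have lenX: "length (X ! j) = expo j" if "X \<in> box \<alpha>" for X
    using nth_in_nlists[OF that j] by (simp add: in_nlists_iff)
  have "(\<lambda>X\<in>box \<alpha>. h ((F p X)[j := F p X ! j @ [F p X ! j ! i]])) \<in> \<rho>"
  proof (cases "?q ! i")
    case (Some c)
    have "Some c \<in> set ?q"
      using Some i q(1) nth_mem by metis
    then have "p(j := ?q @ [Some c]) \<in> patterns (N(j := Suc m))"
      using q by (intro upd) auto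
    then have "(\<lambda>X\<in>box \<alpha>. h (F (p(j := ?q @ [Some c])) X)) \<in> \<rho>"
      using h unfolding restrictions_mem_def F_def by blast
    also have "(\<lambda>X\<in>box \<alpha>. h (F (p(j := ?q @ [Some c])) X)) =
        (\<lambda>X\<in>box \<alpha>. h ((F p X)[j := F p X ! j @ [F p X ! j ! i]]))"
    proof (intro restrict_ext arg_cong[of _ _ h])
      fix X assume X: "X \<in> box \<alpha>"
      have "fill ?q (X ! j) ! i = c"
        using Some i q lenX[OF X] by (simp add: fill_eq_map)
      then have "F p X ! j @ [F p X ! j ! i] = fill (?q @ [Some c]) (X ! j)"
        using q lenX[OF X] by (simp add: F_nth fill_snoc_Some)
      then show "F (p(j := ?q @ [Some c])) X = (F p X)[j := F p X ! j @ [F p X ! j ! i]]"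
        using F_upd[OF X] by simp
    qed
    finally show ?thesis .
  next
    case None
    \<comment> \<open>The index of variable \<open>i\<close> among those kept by
      \<open>?q\<close>.\<close>
    define i' where "i' = count_list (take i ?q) None"
    have i': "i' < expo j"
      using count_list_take_less[of i ?q None] None i q by (simp add: i'_def)
    define H where "H X = h (F (p(j := ?q @ [None])) X)" for X
    have "subst_at \<alpha> j (insert_nth l c) H \<in> \<rho>" if "l \<le> expo j" "c \<in> base j" for l c
    proof -
      \<comment> \<open>Fixing one of the \<open>expo j + 1\<close> kept variables restores the
        right number, so each section of \<open>H\<close> is a restriction of \<open>h\<close> by a
        pattern.\<close>
      have "l < count_list (?q @ [None]) None"
        using that q by simp
      from fill_insert_nth_substitute[OF this, of c] obtain r where
        r: "length r = Suc m" "count_list r None = expo j" "\<And>a. Some a \<in> set r \<Longrightarrow> a = c \<or> Some a \<in> set ?q"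
          "\<And>xs. length xs = expo j \<Longrightarrow> fill (?q @ [None]) (insert_nth l c xs) = fill r xs"
        using q by auto
      have "p(j := r) \<in> patterns (N(j := Suc m))"
        using r q(3) that by (intro upd) blast+
      then have "(\<lambda>X\<in>box \<alpha>. h (F (p(j := r)) X)) \<in> \<rho>"
        using h unfolding restrictions_mem_def F_def by blast
      also have "(\<lambda>X\<in>box \<alpha>. h (F (p(j := r)) X)) = subst_at \<alpha> j (insert_nth l c) H"
        unfolding subst_at_def H_def
      proof (intro restrict_ext arg_cong[of _ _ h])
        fix X assume X: "X \<in> box \<alpha>"
        show "F (p(j := r)) X = F (p(j := ?q @ [None])) (X[j := insert_nth l c (X ! j)])"
          using F_upd[OF X, of r "X ! j"] F_upd[OF X, of "?q @ [None]" "insert_nth l c (X ! j)"]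
            r(4)[OF lenX[OF X]] by simp
      qed
      finally show ?thesis .
    qed
    then have "subst_at \<alpha> j (\<lambda>x. insert_nth (expo j) (x ! i') x) H \<in> \<rho>"
      using i' j by (intro identify_mem) auto
    also have "subst_at \<alpha> j (\<lambda>x. insert_nth (expo j) (x ! i') x) H =
        (\<lambda>X\<in>box \<alpha>. h ((F p X)[j := F p X ! j @ [F p X ! j ! i]]))"
      unfolding subst_at_def H_def
    proof (intro restrict_ext arg_cong[of _ _ h])
      fix X assume X: "X \<in> box \<alpha>"
      have "fill ?q (X ! j) ! i = X ! j ! i'"
        using None i q lenX[OF X] by (simp add: fill_eq_map i'_def)
      then have "F p X ! j @ [F p X ! j ! i] = fill (?q @ [None]) (X ! j @ [X ! j ! i'])"
        using q lenX[OF X] by (simp add: F_nth fill_snoc_None)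
      moreover have "insert_nth (expo j) (X ! j ! i') (X ! j) = X ! j @ [X ! j ! i']"
        using lenX[OF X] by (simp add: insert_nth_def)
      ultimately show "F (p(j := ?q @ [None])) (X[j := insert_nth (expo j) (X ! j ! i') (X ! j)]) =
          (F p X)[j := F p X ! j @ [F p X ! j ! i]]"
        using F_upd[OF X] by simp
    qed
    finally show ?thesis .
  qed
  then show "(\<lambda>X\<in>box \<alpha>. h ((map (\<lambda>j. fill (p j) (X ! j)) [0..<length \<alpha>])
      [j := map (\<lambda>j. fill (p j) (X ! j)) [0..<length \<alpha>] ! j @
        [map (\<lambda>j. fill (p j) (X ! j)) [0..<length \<alpha>] ! j ! i]])) \<in> \<rho>"
    by (simp add: F_def)
qed

section \<open>Cyclic identification of variables\<close>

definition cyclic :: "(nat \<Rightarrow> nat) \<Rightarrow> 'b list list \<Rightarrow> 'b list list" where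
  "cyclic N X = map (\<lambda>j. map (\<lambda>l. X ! j ! (l mod expo j)) [0..<N j]) [0..<length \<alpha>]"

text \<open>Induction on the number of surplus variables. The last variable of sort \<open>j\<close>
  has an index \<open>m\<close> with \<open>expo j \<le> m\<close>, so variable
  \<open>m mod expo j\<close> comes earlier; it already carries the entry
  \<open>m mod expo j\<close> of \<open>X ! j\<close>, which is the one that variable
  \<open>m\<close> must get.\<close>

lemma restrictions_mem_cyclic:
  assumes "restrictions_mem N h" and "\<And>j. j < length \<alpha> \<Longrightarrow> expo j \<le> N j"
  shows "(\<lambda>X\<in>box \<alpha>. h (cyclic N X)) \<in> \<rho>"
  using assms
proof (induction "\<Sum>j<length \<alpha>. N j - expo j" arbitrary: N h)
  case 0
  then have N: "N j = expo j" if "j < length \<alpha>" for j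
    using that le_antisym[of "N j" "expo j"] by auto
  have "(\<lambda>j. replicate (expo j) None) \<in> patterns N"
    using N by (simp add: patterns_def count_list_replicate_same)
  then have "(\<lambda>X\<in>box \<alpha>. h (map (\<lambda>j. fill (replicate (expo j) None) (X ! j)) [0..<length \<alpha>])) \<in> \<rho>"
    using 0(2) by (simp add: restrictions_mem_def)
  also have "(\<lambda>X\<in>box \<alpha>. h (map (\<lambda>j. fill (replicate (expo j) None) (X ! j)) [0..<length \<alpha>])) =
      (\<lambda>X\<in>box \<alpha>. h (cyclic N X))"
  proof (intro restrict_ext arg_cong[of _ _ h])
    fix X assume X: "X \<in> box \<alpha>"
    have "fill (replicate (expo j) None) (X ! j) = map (\<lambda>l. X ! j ! (l mod expo j)) [0..<N j]"
      if "j < length \<alpha>" for j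
      using nth_in_nlists[OF X that] N[OF that]
      by (auto simp: in_nlists_iff fill_replicate_None intro!: nth_equalityI)
    then show "map (\<lambda>j. fill (replicate (expo j) None) (X ! j)) [0..<length \<alpha>] = cyclic N X"
      by (simp add: cyclic_def)
  qed
  finally show ?case .
next
  case (Suc k)
  have "(\<Sum>j<length \<alpha>. N j - expo j) \<noteq> 0"
    using Suc.hyps(2) by linarith
  then have "\<exists>j\<in>{..<length \<alpha>}. N j - expo j \<noteq> 0"
    by (rule contrapos_np) (auto intro!: sum.neutral)
  then obtain j where j: "j < length \<alpha>" "N j - expo j \<noteq> 0"
    unfolding Bex_def lessThan_iff by (elim exE conjE)
  then obtain m where m: "N j = Suc m" "expo j \<le> m"
    by (cases "N j") auto
  have mod: "m mod expo j < m"
    using m(2) exponent_pos[OF j(1)] mod_less_divisor[of "expo j" m] by linarith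
  have N: "N = N(j := Suc m)"
    using m by auto
  have h: "restrictions_mem (N(j := m)) (\<lambda>Y. h (Y[j := Y ! j @ [Y ! j ! (m mod expo j)]]))"
    using Suc.prems(1) N j(1) mod by (intro restrictions_mem_identify) simp_all
  have sum: "k = (\<Sum>j'<length \<alpha>. (N(j := m)) j' - expo j')"
  proof -
    have "(\<Sum>j'<length \<alpha>. N j' - expo j') = (N j - expo j) + (\<Sum>j'\<in>{..<length \<alpha>} - {j}. N j' - expo j')"
      using j by (intro sum.remove) auto
    moreover have "(\<Sum>j'<length \<alpha>. (N(j := m)) j' - expo j') =
        (m - expo j) + (\<Sum>j'\<in>{..<length \<alpha>} - {j}. (N(j := m)) j' - expo j')"
      using j by (subst sum.remove[of _ j]) auto
    moreover have "(\<Sum>j'\<in>{..<length \<alpha>} - {j}. (N(j := m)) j' - expo j') =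
        (\<Sum>j'\<in>{..<length \<alpha>} - {j}. N j' - expo j')"
      by (intro sum.cong) auto
    ultimately show ?thesis
      using Suc.hyps(2) m by simp
  qed
  have "(\<lambda>X\<in>box \<alpha>. h ((cyclic (N(j := m)) X)[j := cyclic (N(j := m)) X ! j @
      [cyclic (N(j := m)) X ! j ! (m mod expo j)]])) \<in> \<rho>"
    using Suc.hyps(1)[OF sum h] Suc.prems(2) m(2) by simp
  moreover have "(cyclic (N(j := m)) X)[j := cyclic (N(j := m)) X ! j @
      [cyclic (N(j := m)) X ! j ! (m mod expo j)]] = cyclic N X" for X
    using j m mod by (intro nth_equalityI) (auto simp: cyclic_def nth_list_update)
  ultimately show ?case
    by simp
qed

text \<open>As \<open>n * expo j\<close> is a multiple of \<open>expo j\<close>, the cyclic pattern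
  starts anew with every block, and each \<open>gs ! i\<close> is evaluated at \<open>X\<close>
  itself.\<close>

lemma preserves_if_translations:
  assumes Op: "(n, f) \<in> Op A" and trl: "\<And>q. q \<in> trl A (dimension \<alpha>) (n, f) \<Longrightarrow> preserves_rrel q (\<alpha>, \<rho>)"
  shows "preserves_rrel (n, f) (\<alpha>, \<rho>)"
  unfolding preserves_rrel_def prod.case
proof (intro allI impI)
  fix gs assume gs: "length gs = n \<and> set gs \<subseteq> \<rho>"
  define h where "h Y = f (map (\<lambda>i. (gs ! i) (map (\<lambda>j. take (expo j) (drop (i * expo j) (Y ! j)))
    [0..<length \<alpha>])) [0..<n])" for Y
  have n: "n \<ge> 1"
    using Op by (simp add: Op_def)
  have "restrictions_mem (\<lambda>j. n * expo j) h"
    using restrictions_mem_blocks[OF Op trl] gs unfolding h_def by blast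
  then have "(\<lambda>X\<in>box \<alpha>. h (cyclic (\<lambda>j. n * expo j) X)) \<in> \<rho>"
    using n by (intro restrictions_mem_cyclic) auto
  also have "(\<lambda>X\<in>box \<alpha>. h (cyclic (\<lambda>j. n * expo j) X)) = (\<lambda>X\<in>box \<alpha>. f (map (\<lambda>g. g X) gs))"
  proof (intro restrict_ext)
    fix X assume X: "X \<in> box \<alpha>"
    have "map (\<lambda>j. take (expo j) (drop (i * expo j) (cyclic (\<lambda>j. n * expo j) X ! j))) [0..<length \<alpha>] = X"
      if i: "i < n" for i
    proof (rule nth_equalityI)
      fix j assume "j < length (map (\<lambda>j. take (expo j) (drop (i * expo j) (cyclic (\<lambda>j. n * expo j) X ! j)))
        [0..<length \<alpha>])"
      then have j: "j < length \<alpha>" by simp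
      have "Suc i * expo j \<le> n * expo j" "i * expo j \<le> n * expo j"
        using i by (intro mult_le_mono1; simp)+
      then show "map (\<lambda>j. take (expo j) (drop (i * expo j) (cyclic (\<lambda>j. n * expo j) X ! j))) [0..<length \<alpha>] ! j
          = X ! j"
        using j nth_in_nlists[OF X j]
        by (intro nth_equalityI) (auto simp: cyclic_def in_nlists_iff)
    qed (simp add: length_of_box[OF X])
    then have "h (cyclic (\<lambda>j. n * expo j) X) = f (map (\<lambda>i. (gs ! i) X) [0..<n])"
      unfolding h_def by (intro arg_cong[of _ _ f] map_cong refl) (simp only: set_upt atLeastLessThan_iff)
    also have "map (\<lambda>i. (gs ! i) X) [0..<n] = map (\<lambda>g. g X) gs"
      using gs by (intro nth_equalityI) auto
    finally show "h (cyclic (\<lambda>j. n * expo j) X) = f (map (\<lambda>g. g X) gs)" .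
  qed
  finally show "(\<lambda>X\<in>box \<alpha>. f (map (\<lambda>g. g X) gs)) \<in> \<rho>" .
qed

lemma const_op_preserves:
  assumes "c \<in> A"
  shows "preserves_rrel (const_op A n c) (\<alpha>, \<rho>)"
  unfolding preserves_rrel_def const_op_def prod.case
proof (intro allI impI)
  fix gs assume gs: "length gs = n \<and> set gs \<subseteq> \<rho>"
  have "map (\<lambda>g. g X) gs \<in> nlists n A" if "X \<in> box \<alpha>" for X
    using gs mem_values[OF _ that] by (auto simp: in_nlists_iff)
  then have "(\<lambda>X\<in>box \<alpha>. (\<lambda>xs\<in>nlists n A. c) (map (\<lambda>g. g X) gs)) = (\<lambda>X\<in>box \<alpha>. c)"
    by (intro restrict_ext) simp
  then show "(\<lambda>X\<in>box \<alpha>. (\<lambda>xs\<in>nlists n A. c) (map (\<lambda>g. g X) gs)) \<in> \<rho>"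
    using const_mem[OF assms] by simp
qed

end

section \<open>From generalized quasiorders to the equivalences\<close>

lemma generalized_quasiorder_GQuord:
  assumes "(\<alpha>, \<rho>) \<in> GQuord d A" and "A \<noteq> {}"
  shows "generalized_quasiorder A \<alpha> \<rho>" and "dimension \<alpha> = d"
proof -
  have "canonical_arity \<alpha>"
    using assms(1) by (auto simp: GQuord_def)
  moreover have "snd (\<alpha> ! j) \<ge> 1" if "j < length \<alpha>" for j
    using nth_mem[OF that] \<open>canonical_arity \<alpha>\<close> by (auto simp: canonical_arity_def case_prod_beta)
  ultimately show "generalized_quasiorder A \<alpha> \<rho>"
    using assms canonical_box_not_empty by unfold_locales (auto simp: GQuord_def)
qed (use assms in \<open>auto simp: GQuord_def\<close>)

text \<open>Generalized quasiorders contain the constant functions, so constants are polymorphisms,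
  and hence so are all translations of polymorphisms. The reverse inclusion is checked for each
  member of \<open>Q'\<close> separately.\<close>

lemma Xi_if_Pol_GQuord:
  assumes "A \<noteq> {}" and "d \<ge> 1" and "Q \<subseteq> Rel A"
    and Q': "Q' \<subseteq> GQuord d A" and Pol: "Pol A Q = Pol_rrel A Q'"
  shows "Xi A d Q"
  unfolding Xi_def
proof
  have const: "const_op A d c \<in> Pol A Q" if "c \<in> A" for c
  proof -
    have "preserves_rrel (const_op A d c) \<sigma>" if \<sigma>: "\<sigma> \<in> Q'" for \<sigma>
    proof -
      obtain \<alpha> \<rho> where eq: "\<sigma> = (\<alpha>, \<rho>)" by force
      have "(\<alpha>, \<rho>) \<in> GQuord d A"
        using Q' \<sigma> eq by blast
      then show ?thesis
        unfolding eq using \<open>A \<noteq> {}\<close> \<open>c \<in> A\<close>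
        by (intro generalized_quasiorder.const_op_preserves generalized_quasiorder_GQuord(1))
    qed
    moreover have "const_op A d c \<in> Op A"
      using that \<open>d \<ge> 1\<close> by (auto simp: Op_def const_op_def)
    ultimately show ?thesis
      by (simp add: Pol Pol_rrel_def)
  qed
  show "Pol A Q \<subseteq> star_op A d (dary d (Pol A Q))"
    by (rule clone_subset_star_op[OF is_clone_Pol[OF assms(3)] const])
  show "star_op A d (dary d (Pol A Q)) \<subseteq> Pol A Q"
  proof (intro subrelI)
    fix n f assume "(n, f) \<in> star_op A d (dary d (Pol A Q))"
    then have Op: "(n, f) \<in> Op A" and trl: "\<And>q. q \<in> trl A d (n, f) \<Longrightarrow> q \<in> Pol_rrel A Q'"
      by (auto simp: star_op_def dary_def Pol)
    have "preserves_rrel (n, f) (\<alpha>, \<rho>)" if "(\<alpha>, \<rho>) \<in> Q'" for \<alpha> \<rho>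
    proof -
      have GQ: "(\<alpha>, \<rho>) \<in> GQuord d A"
        using Q' that by blast
      show ?thesis
      proof (rule generalized_quasiorder.preserves_if_translations[OF
            generalized_quasiorder_GQuord(1)[OF GQ \<open>A \<noteq> {}\<close>] Op])
        show "preserves_rrel q (\<alpha>, \<rho>)" if "q \<in> trl A (dimension \<alpha>) (n, f)" for q
          using trl[of q] that generalized_quasiorder_GQuord(2)[OF GQ \<open>A \<noteq> {}\<close>] \<open>(\<alpha>, \<rho>) \<in> Q'\<close>
          by (simp add: Pol_rrel_def)
      qed
    qed
    then show "(n, f) \<in> Pol A Q"
      using Op by (auto simp: Pol Pol_rrel_def)
  qed
qed

theorem proposition7p5:
  fixes A :: "'a set" and d :: nat and Q :: "'a frel set"
    and e :: "nat \<Rightarrow> 'a" and en :: "nat arity \<Rightarrow> nat \<Rightarrow> nat list list"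
  assumes "finite A" and "A \<noteq> {}" and "d \<ge> 1" and "Q \<subseteq> Rel A"
    and "bij_betw e {..<card A} A"
    and "\<And>\<alpha>. canonical_arity \<alpha> \<Longrightarrow> bij_betw (en \<alpha>) {..<card (box \<alpha>)} (box \<alpha>)"
  shows
    "(Xi A d Q \<longleftrightarrow>
        (\<exists>Q'. Q' \<subseteq> GQuord d A \<and> Pol A Q = Pol_rrel A Q' \<and>
              Pol_rrel A Q' = Pol A (ring_rel en ` Q'))) \<and>
     (Xi A d Q \<longleftrightarrow>
        (\<exists>Q'. Q' \<subseteq> GQuord d A \<and> rel_clone A Q = rel_clone A (ring_rel en ` Q'))) \<and>
     (Xi A d Q \<longleftrightarrow>
        (\<exists>M. clone_fragment A d M \<and> (\<forall>c\<in>A. const_op A d c \<in> M) \<and>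
             ops_rrel e A d M \<in> GQuord d A \<and>
             rel_clone A Q = rel_clone A {ring_rel en (ops_rrel e A d M)}))"
proof -
  note en = assms(6)
  let ?ii = "\<exists>Q'. Q' \<subseteq> GQuord d A \<and> Pol A Q = Pol_rrel A Q' \<and> Pol_rrel A Q' = Pol A (ring_rel en ` Q')"
  let ?ii' = "\<exists>Q'. Q' \<subseteq> GQuord d A \<and> rel_clone A Q = rel_clone A (ring_rel en ` Q')"
  let ?iii = "\<exists>M. clone_fragment A d M \<and> (\<forall>c\<in>A. const_op A d c \<in> M) \<and>
    ops_rrel e A d M \<in> GQuord d A \<and> rel_clone A Q = rel_clone A {ring_rel en (ops_rrel e A d M)}"
  \<comment> \<open>Equality of relational clones is reduced to
    \<open>Pol A Q = Pol_rrel A Q'\<close>, in which the enumeration \<open>en\<close> no longer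
    occurs.\<close>
  have ring: "rel_clone A Q = rel_clone A (ring_rel en ` Q') \<longleftrightarrow> Pol A Q = Pol_rrel A Q'"
    "Pol A (ring_rel en ` Q') = Pol_rrel A Q'" if "Q' \<subseteq> GQuord d A" for Q'
    using rel_clone_eq_iff[OF assms(1,4) ring_rel_GQuord_subset_Rel[OF that en]] Pol_ring_rel[OF that en]
    by simp_all
  have "?iii" if Xi: "Xi A d Q"
  proof -
    let ?C = "Pol A Q"
    have C: "is_clone A ?C"
      by (rule is_clone_Pol[OF assms(4)])
    have const: "const_op A d c \<in> ?C" if "c \<in> A" for c
      by (rule Xi_imp_constants[OF assms(4) Xi that])
    have star: "star_op A d (dary d ?C) \<subseteq> ?C"
      using Xi by (simp add: Xi_def)
    have GQ: "ops_rrel e A d (dary d ?C) \<in> GQuord d A"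
      using assms C const star by (intro ops_rrel_in_GQuord)
    moreover have "Pol_rrel A {ops_rrel e A d (dary d ?C)} = ?C"
      using assms C const star by (intro Pol_rrel_ops_rrel)
    then have "rel_clone A Q = rel_clone A {ring_rel en (ops_rrel e A d (dary d ?C))}"
      using ring(1)[of "{ops_rrel e A d (dary d ?C)}"] GQ by simp
    moreover have "const_op A d c \<in> dary d ?C" if "c \<in> A" for c
      using const[OF that] by (simp add: dary_def const_op_def)
    ultimately show ?thesis
      using clone_fragment_dary[OF C] by blast
  qed
  moreover have "?ii'" if iii: "?iii"
  proof -
    obtain M where "ops_rrel e A d M \<in> GQuord d A"
        "rel_clone A Q = rel_clone A {ring_rel en (ops_rrel e A d M)}"
      using iii by blast
    then show ?thesis
      by (intro exI[of _ "{ops_rrel e A d M}"]) simp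
  qed
  moreover have "?ii' \<longleftrightarrow> ?ii"
    using ring by metis
  moreover have "Xi A d Q" if "?ii"
    using that Xi_if_Pol_GQuord[OF assms(2,3,4)] by blast
  ultimately show ?thesis
    by blast
qed

end
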